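(* Let $f:\mathbb T^n\to\mathbb T^n$ be a linear Anosov diffeomorphism, $n\ge2$. The following hold: (1) if $n=2$ and $g\in\mathcal Z^1(f)$, then there are $k,\ell\in\mathbb Z$, not both zero, such that $f^kg^\ell=\mathrm{id}$; (2) if $n=3$ and $g,h\in\mathcal Z^1(f)$, then there are $k,\ell,m\in\mathbb Z$, not all zero, such that $f^kg^\ell h^m=\mathrm{id}$.
   Context: $\mathbb T^n=\mathbb R^n/\mathbb Z^n$. A linear Anosov diffeomorphism of $\mathbb T^n$ is the diffeomorphism induced by a matrix $A\in GL(n,\mathbb Z)$, $|\det A|=1$, with no eigenvalue of modulus $1$. $\mathcal Z^1(f)$ is the group of $C^1$ diffeomorphisms $g$ of $\mathbb T^n$ with $g\circ f=f\circ g$. *)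

theory Defs
  imports "HOL-Analysis.Analysis"
begin

definition torus_rel :: "real ^ 'n \<Rightarrow> real ^ 'n \<Rightarrow> bool" where
  "torus_rel x y \<longleftrightarrow> (\<forall>i. x $ i - y $ i \<in> \<int>)"

lemma equivp_torus_rel: "equivp torus_rel"
proof (rule equivpI)
  show "reflp torus_rel"
    by (simp add: reflp_def torus_rel_def)
  show "symp torus_rel"
    unfolding symp_def torus_rel_def by (metis Ints_minus minus_diff_eq)
  show "transp torus_rel"
  proof (rule transpI, unfold torus_rel_def, rule allI)
    fix x y z :: "real ^ 'n" and i
    assume "\<forall>i. x $ i - y $ i \<in> \<int>" "\<forall>i. y $ i - z $ i \<in> \<int>"
    then have "(x $ i - y $ i) + (y $ i - z $ i) \<in> \<int>"
      by (intro Ints_add) auto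
    then show "x $ i - z $ i \<in> \<int>" by simp
  qed
qed

quotient_type 'n torus = "real ^ 'n::finite" / torus_rel
  by (rule equivp_torus_rel)

abbreviation torus_proj :: "real ^ 'n \<Rightarrow> 'n::finite torus" where
  "torus_proj \<equiv> abs_torus"


definition C1_on :: "'a::real_normed_vector set \<Rightarrow> ('a \<Rightarrow> 'b::real_normed_vector) \<Rightarrow> bool" where
  "C1_on U G \<longleftrightarrow>
     (\<exists>G' :: 'a \<Rightarrow> 'a \<Rightarrow>\<^sub>L 'b.
        (\<forall>x\<in>U. (G has_derivative blinfun_apply (G' x)) (at x)) \<and> continuous_on U G')"

text \<open>The smooth structure of the torus is the one for which the projection is a local
  diffeomorphism: its charts are the inverses of the projection restricted to open sets
  on which it is injective. A map is \<open>C\<^sup>1\<close> at \<open>p\<close> if it is \<open>C\<^sup>1\<close> in suitable charts around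
  \<open>p\<close> and \<open>g p\<close>. This includes continuity of \<open>g\<close> at \<open>p\<close> for the quotient topology.\<close>

definition torus_C1_at :: "('n::finite torus \<Rightarrow> 'n torus) \<Rightarrow> 'n torus \<Rightarrow> bool" where
  "torus_C1_at g p \<longleftrightarrow>
     (\<exists>U V. open U \<and> inj_on torus_proj U \<and> p \<in> torus_proj ` U \<and>
            open V \<and> inj_on torus_proj V \<and> g ` torus_proj ` U \<subseteq> torus_proj ` V \<and>
            C1_on U (inv_into V torus_proj \<circ> g \<circ> torus_proj))"

definition torus_C1 :: "('n::finite torus \<Rightarrow> 'n torus) \<Rightarrow> bool" where
  "torus_C1 g \<longleftrightarrow> (\<forall>p. torus_C1_at g p)"

definition torus_C1_diffeo :: "('n::finite torus \<Rightarrow> 'n torus) \<Rightarrow> bool" where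
  "torus_C1_diffeo g \<longleftrightarrow> bij g \<and> torus_C1 g \<and> torus_C1 (inv g)"

definition C1_centralizer :: "('n::finite torus \<Rightarrow> 'n torus) \<Rightarrow> ('n torus \<Rightarrow> 'n torus) set" where
  "C1_centralizer f = {g. torus_C1_diffeo g \<and> g \<circ> f = f \<circ> g}"


lift_definition toral_endo :: "int ^ 'n ^ 'n \<Rightarrow> 'n::finite torus \<Rightarrow> 'n torus"
  is "\<lambda>A x. map_matrix real_of_int A *v x"
proof -
  fix A :: "int ^ 'n ^ 'n" and x y :: "real ^ 'n"
  assume "torus_rel x y"
  then have "(\<Sum>j\<in>UNIV. real_of_int (A $ i $ j) * (x $ j - y $ j)) \<in> \<int>" for i
    unfolding torus_rel_def by (intro Ints_sum Ints_mult) auto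
  then show "torus_rel (map_matrix real_of_int A *v x) (map_matrix real_of_int A *v y)"
    by (simp add: torus_rel_def matrix_vector_mult_def algebra_simps sum_subtractf)
qed

definition complex_eigenvalue :: "int ^ 'n ^ 'n \<Rightarrow> complex \<Rightarrow> bool" where
  "complex_eigenvalue A c \<longleftrightarrow>
     (\<exists>v :: complex ^ 'n. v \<noteq> 0 \<and> map_matrix of_int A *v v = c *s v)"

definition linear_anosov :: "('n::finite torus \<Rightarrow> 'n torus) \<Rightarrow> bool" where
  "linear_anosov f \<longleftrightarrow>
     (\<exists>A :: int ^ 'n ^ 'n. invertible A \<and> \<bar>det A\<bar> = 1 \<and>
        (\<forall>c. complex_eigenvalue A c \<longrightarrow> cmod c \<noteq> 1) \<and> f = toral_endo A)"


definition int_iterate :: "('a \<Rightarrow> 'a) \<Rightarrow> int \<Rightarrow> 'a \<Rightarrow> 'a" where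
  "int_iterate f k = (if k \<ge> 0 then f ^^ nat k else inv f ^^ nat (- k))"

end

theory Submission
  imports Defs "HOL-Computational_Algebra.Fundamental_Theorem_Algebra"
begin

text \<open>
  The theorem combines the rigidity of maps commuting with a hyperbolic toral automorphism with the
  upper bound on the rank in Dirichlet's unit theorem.

  Let \<open>f\<close> be induced by the integer matrix \<open>A\<close> and let \<open>g\<close> commute with \<open>f\<close>. The fixed points of
  \<open>f\<close> are finite in number and permuted by \<open>g\<close>, so some power of \<open>g\<close> fixes the origin. Lift this power
  to Euclidean space. The lift differs from a linear map, given by an integer matrix \<open>B\<close>, by a
  bounded function \<open>u\<close> with \<open>u (A x) = A (u x)\<close>. No nonzero vector has a bounded full orbit under
  a hyperbolic matrix, so \<open>u = 0\<close> (\<open>commuting_lift_linear\<close>). Thus a power of \<open>g\<close> is the linear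
  automorphism given by a unimodular integer matrix \<open>B\<close> commuting with \<open>A\<close>
  (\<open>centralizer_power_linear\<close>).

  In dimensions \<open>n = 2\<close> and \<open>n = 3\<close> the eigenvalues of \<open>A\<close> are distinct: a multiple root of the
  characteristic polynomial would be rational, and rational eigenvalues of unimodular integer
  matrices are \<open>1\<close> or \<open>-1\<close> (\<open>hyperbolic_diagonalizable\<close>). All matrices commuting with \<open>A\<close> are
  therefore diagonal in one eigenbasis. Sending such a matrix to the logarithms of the
  absolute values of its eigenvalues is a homomorphism to \<open>n\<close>-space. On unimodular integer
  matrices its image lies in the hyperplane of vectors with coordinate sum zero, and only finitely
  many matrices map to a bounded region. A logarithmic box of size \<open>N\<close> thus contains only
  \<open>O(N ^ (n - 1))\<close> units (\<open>card_units_log_box\<close>).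

  Now take \<open>n\<close> units, \<open>A\<close> and the linear powers of the \<open>n - 1\<close> given maps. Their products with
  exponents at most \<open>N\<close> number \<open>(N + 1) ^ n\<close> and lie in a box of size linear in \<open>N\<close>, so two of them
  coincide for large \<open>N\<close>. Cancelling gives the required relation; this takes place in the group of
  torus maps and uses that \<open>g\<close> commutes with \<open>f\<close> (\<open>coincidence_imp_relation\<close>).
\<close>

section \<open>Characteristic polynomials and distinct eigenvalues\<close>

definition charpoly :: "'a::comm_ring_1 ^ 'n ^ 'n \<Rightarrow> 'a poly" where
  "charpoly A = det (\<chi> i j. [:- A $ i $ j, of_bool (i = j):])"

lemma poly_charpoly: "poly (charpoly A) c = det (mat c - A)"
  unfolding charpoly_def det_def
  by (auto simp: poly_sum poly_prod mat_def of_bool_def if_distrib cong: if_cong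
      intro!: sum.cong prod.cong arg_cong2[where f = "(*)"])

text \<open>In the Leibniz expansion only the identity permutation meets all diagonal entries, the sole
entries of degree one; every other permutation therefore contributes a polynomial of degree
smaller than the dimension.\<close>

lemma charpoly_monic:
  fixes A :: "'a::idom ^ 'n ^ 'n"
  shows "degree (charpoly A) = CARD('n)" and "lead_coeff (charpoly A) = 1"
proof -
  define M where "M = (\<lambda>i j. [:- A $ i $ j, of_bool (i = j):])"
  let ?t = "\<lambda>p. of_int (sign p) * (\<Prod>i\<in>UNIV. M i (p i))"
  let ?S = "{p. p permutes (UNIV :: 'n set)}"
  have cp: "charpoly A = sum ?t ?S"
    by (simp add: charpoly_def det_def M_def)
  have deg: "degree (?t p) < CARD('n)" if "p \<in> ?S - {id}" for p
  proof -
    have "\<exists>i. p i \<noteq> i"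
      using that by (auto simp: fun_eq_iff)
    then obtain i0 where i0: "p i0 \<noteq> i0" by blast
    have "degree (?t p) \<le> degree (of_int (sign p) :: 'a poly) + degree (\<Prod>i\<in>UNIV. M i (p i))"
      by (rule degree_mult_le)
    also have "\<dots> = degree (\<Prod>i\<in>UNIV. M i (p i))"
      by simp
    also have "\<dots> \<le> (\<Sum>i\<in>UNIV. degree (M i (p i)))"
      using degree_prod_sum_le[of UNIV "\<lambda>i. M i (p i)"] by (simp add: o_def)
    also have "\<dots> < (\<Sum>i\<in>(UNIV::'n set). 1)"
      by (rule sum_strict_mono2[of UNIV UNIV "{i0}"] | rule sum_strict_mono_ex1)
         (use i0 in \<open>auto simp: M_def intro!: exI[of _ i0]\<close>)
    finally show ?thesis by simp
  qed
  have id: "degree (?t id) = CARD('n)" "coeff (?t id) (CARD('n)) = 1"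
  proof -
    have eq: "?t id = (\<Prod>i\<in>UNIV. M i i)" by simp
    show d: "degree (?t id) = CARD('n)"
      unfolding eq by (subst degree_prod_sum_eq) (auto simp: M_def)
    have "lead_coeff (?t id) = 1"
      unfolding eq by (subst lead_coeff_prod) (simp add: M_def)
    then show "coeff (?t id) (CARD('n)) = 1" using d by simp
  qed
  have split: "charpoly A = ?t id + sum ?t (?S - {id})"
    unfolding cp by (rule sum.remove) (auto simp: permutes_id)
  have c0: "coeff (sum ?t (?S - {id})) k = 0" if "k \<ge> CARD('n)" for k
    unfolding coeff_sum
    by (rule sum.neutral) (use deg that in \<open>auto intro!: coeff_eq_0\<close>, fastforce)
  have c1: "coeff (charpoly A) (CARD('n)) = 1"
    using c0 id(2) unfolding split by simp
  have c2: "coeff (charpoly A) k = 0" if "k > CARD('n)" for k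
    using c0[of k] that id(1) unfolding split by (auto intro!: coeff_eq_0)
  show d: "degree (charpoly A) = CARD('n)"
    by (rule antisym) (use c1 c2 in \<open>auto intro!: degree_le le_degree\<close>)
  show "lead_coeff (charpoly A) = 1" using c1 d by simp
qed

lemma Ints_coeff_prod:
  assumes "\<And>i k. i \<in> I \<Longrightarrow> coeff (f i) k \<in> \<int>"
  shows "coeff (prod f I) k \<in> \<int>"
  using assms
proof (induction I arbitrary: k rule: infinite_finite_induct)
  case (insert i I)
  then show ?case by (auto simp: coeff_mult intro!: Ints_sum Ints_mult)
qed (auto simp: coeff_1)

lemma Ints_coeff_charpoly:
  assumes "\<And>i j. A $ i $ j \<in> \<int>"
  shows "coeff (charpoly A) k \<in> \<int>"
proof -
  have "coeff (\<Prod>i\<in>UNIV. [:- A $ i $ p i, of_bool (i = p i):]) k \<in> \<int>" for p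
    by (rule Ints_coeff_prod) (auto simp: coeff_pCons assms split: nat.split)
  then show ?thesis
    unfolding charpoly_def det_def
    by (auto simp: coeff_sum of_int_poly intro!: Ints_sum Ints_mult)
qed

lemma charpoly_root_iff:
  fixes A :: "'a::field ^ 'n ^ 'n"
  shows "poly (charpoly A) c = 0 \<longleftrightarrow> (\<exists>v. v \<noteq> 0 \<and> A *v v = c *s v)"
proof -
  have mc: "(mat c - A) *v v = c *s v - A *v v" for v
    by (simp add: vec_eq_iff matrix_vector_mult_def mat_def if_distribR left_diff_distrib
        sum_subtractf cong: if_cong) (simp add: if_distrib if_distribR cong: if_cong)
  have "poly (charpoly A) c = 0 \<longleftrightarrow> \<not> invertible (mat c - A)"
    by (simp add: poly_charpoly invertible_det_nz)
  also have "\<dots> \<longleftrightarrow> (\<exists>v. v \<noteq> 0 \<and> (mat c - A) *v v = 0)"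
    by (metis invertible_left_inverse matrix_left_invertible_ker)
  finally show ?thesis unfolding mc by (metis eq_iff_diff_eq_0)
qed

text \<open>An eigenvalue of an integer matrix is an algebraic integer, being a root of the monic
characteristic polynomial with integer coefficients.\<close>

lemma rational_eigenvalue_Ints:
  fixes A :: "'a::field_char_0 ^ 'n ^ 'n"
  assumes "\<And>i j. A $ i $ j \<in> \<int>" "v \<noteq> 0" "A *v v = z *s v" "z \<in> \<rat>"
  shows "z \<in> \<int>"
proof -
  have "poly (charpoly A) z = 0"
    using assms charpoly_root_iff by blast
  then have "algebraic_int z"
    using charpoly_monic(2)[of A] Ints_coeff_charpoly[of A] assms(1)
    by (intro algebraic_int.intros[of "charpoly A"]) auto
  then show ?thesis
    using assms(4) rational_algebraic_int_is_int by blast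
qed

text \<open>Over the rationals an irreducible polynomial is separable, so a polynomial of degree at most
three with a multiple root must split off a rational factor, and the multiple root itself is
rational. For degree three this is made explicit by one step of the Euclidean algorithm for
\<open>p\<close> and its derivative, whose remainder is linear in \<open>z\<close>. This is the one place where the
dimension has to be two or three for the eigenvalues to be controlled.\<close>

lemma multiple_root_rational:
  fixes p :: "'a::field_char_0 poly"
  assumes deg: "degree p = 2 \<or> degree p = 3" and lc: "lead_coeff p = 1"
    and rat: "\<And>k. coeff p k \<in> \<rat>" and root: "poly p z = 0" "poly (pderiv p) z = 0"
  shows "z \<in> \<rat>"
  using deg
proof
  assume d: "degree p = 2"
  define a where "a = coeff p 1"
  have "a \<in> \<rat>" using rat a_def by blast
  have p: "p = [:coeff p 0, a, 1:]"
  proof (rule poly_eqI)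
    fix n show "coeff p n = coeff [:coeff p 0, a, 1:] n"
      using d lc by (cases "n \<le> 2") (auto simp: a_def coeff_pCons numeral_2_eq_2 coeff_eq_0
          le_Suc_eq split: nat.splits)
  qed
  have "poly (pderiv p) z = a + 2 * z"
    by (subst p) (simp add: pderiv_pCons)
  then have "z = - a / 2"
    using root by (simp add: field_simps eq_neg_iff_add_eq_0)
  then show ?thesis using \<open>a \<in> \<rat>\<close> by simp
next
  assume d: "degree p = 3"
  define a b c where "a = coeff p 2" "b = coeff p 1" "c = coeff p 0"
  have R: "a \<in> \<rat>" "b \<in> \<rat>" "c \<in> \<rat>" using rat a_b_c_def by auto
  have p: "p = [:c, b, a, 1:]"
  proof (rule poly_eqI)
    fix n show "coeff p n = coeff [:c, b, a, 1:] n"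
      using d lc by (cases "n \<le> 3") (auto simp: a_b_c_def coeff_pCons numeral_2_eq_2 numeral_3_eq_3
          coeff_eq_0 le_Suc_eq split: nat.splits)
  qed
  have 1: "c + b * z + a * z^2 + z^3 = 0"
    using root(1) by (subst (asm) p) (simp add: algebra_simps power2_eq_square power3_eq_cube)
  have "poly (pderiv p) z = b + 2 * a * z + 3 * z^2"
    by (subst p) (simp add: pderiv_pCons algebra_simps power2_eq_square power3_eq_cube)
  then have 2: "b + 2 * a * z + 3 * z^2 = 0" using root by simp
  have "9 * (c + b * z + a * z^2 + z^3) - (3 * z + a) * (b + 2 * a * z + 3 * z^2)
      = (6 * b - 2 * a^2) * z - (a * b - 9 * c)"
    by (simp add: algebra_simps power2_eq_square power3_eq_cube)
  then have 3: "(6 * b - 2 * a^2) * z = a * b - 9 * c"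
    using 1 2 by simp
  show ?thesis
  proof (cases "6 * b - 2 * a^2 = 0")
    case False
    then have "z = (a * b - 9 * c) / (6 * b - 2 * a^2)"
      by (metis 3 nonzero_mult_div_cancel_left)
    then show ?thesis using R by simp
  next
    case True
    \<comment> \<open>The remainder vanishes identically, so \<open>p'\<close> divides \<open>p\<close>: the case of a triple root.\<close>
    have "2 * (3 * z + a)^2 = 6 * (b + 2 * a * z + 3 * z^2) - (6 * b - 2 * a^2)"
      by (simp add: power2_eq_square algebra_simps)
    also have "\<dots> = 0"
      unfolding 2 True by simp
    finally have "3 * z + a = 0" by simp
    then have "3 * z = - a"
      by (simp only: eq_neg_iff_add_eq_0)
    then have "z = - a / 3" by (metis nonzero_mult_div_cancel_left zero_neq_numeral)
    then show ?thesis using R by simp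
  qed
qed

definition diag :: "('n \<Rightarrow> 'a::zero) \<Rightarrow> 'a ^ 'n ^ 'n" where
  "diag d = (\<chi> i j. if i = j then d i else 0)"

lemma diag_mult:
  fixes M :: "'a::semiring_1 ^ 'n ^ 'n"
  shows "(diag d ** M) $ i $ j = d i * M $ i $ j" and "(M ** diag d) $ i $ j = M $ i $ j * d j"
  by (simp_all add: diag_def matrix_matrix_mult_def if_distrib if_distribR cong: if_cong)

lemma diag_vec: "(diag d *v x) $ i = d i * x $ i"
  by (simp add: diag_def matrix_vector_mult_def if_distrib if_distribR cong: if_cong)

lemma matrix_vector_mult_axis_column: "(A :: 'a::semiring_1 ^ 'n ^ 'm) *v axis j 1 = column j A"
  by (simp add: vec_eq_iff matrix_vector_mult_def column_def axis_def if_distrib if_distribR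
      cong: if_cong)

text \<open>The kernel of \<open>P\<close> is invariant under \<open>diag l\<close>, hence under every polynomial in it. A Lagrange
polynomial in \<open>diag l\<close> isolates one coordinate \<open>x $ i\<close> of a kernel vector \<open>x\<close>, which then kills
the \<open>i\<close>-th eigenvector and so vanishes.\<close>

lemma eigenvector_matrix_invertible:
  fixes A P :: "'a::field ^ 'n ^ 'n"
  assumes AP: "A ** P = P ** diag l" and "inj l" and nz: "\<And>i. column i P \<noteq> 0"
  shows "invertible P"
proof -
  have "x = 0" if Px: "P *v x = 0" for x
  proof -
    have inv: "P *v (\<chi> i. poly q (l i) * x $ i) = 0" for q
    proof (induction q)
      case (pCons a q)
      have eq: "(\<chi> i. poly (pCons a q) (l i) * x $ i)
          = a *s x + diag l *v (\<chi> i. poly q (l i) * x $ i)"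
        by (simp add: vec_eq_iff diag_vec algebra_simps)
      have "P *v (diag l *v (\<chi> i. poly q (l i) * x $ i)) = A *v (P *v (\<chi> i. poly q (l i) * x $ i))"
        by (simp add: matrix_vector_mul_assoc AP)
      also have "\<dots> = 0" using pCons by simp
      finally show ?case
        unfolding eq by (simp add: matrix_vector_right_distrib vec.scale Px)
    qed (simp add: zero_vec_def[symmetric])
    have "x $ i = 0" for i
    proof -
      define q where "q = (\<Prod>j\<in>UNIV - {i}. [:- l j, 1:])"
      have q: "poly q (l k) = 0" if "k \<noteq> i" for k
        using that by (auto simp: q_def poly_prod)
      have qi: "poly q (l i) \<noteq> 0"
        using \<open>inj l\<close> by (auto simp: q_def poly_prod inj_def)
      have "(\<chi> k. poly q (l k) * x $ k) = (poly q (l i) * x $ i) *s axis i 1"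
        by (auto simp: vec_eq_iff axis_def q)
      then have "(poly q (l i) * x $ i) *s column i P = 0"
        using inv[of q] by (simp add: vec.scale matrix_vector_mult_axis_column)
      then show ?thesis
        using qi nz by simp
    qed
    then show ?thesis by (simp add: vec_eq_iff)
  qed
  then show ?thesis
    by (metis invertible_left_inverse matrix_left_invertible_ker)
qed

lemma diagonalizable_if_distinct_roots:
  fixes A :: "'a::field ^ 'n ^ 'n"
  assumes "card {z. poly (charpoly A) z = 0} = CARD('n)"
  obtains P Q :: "'a ^ 'n ^ 'n" and l
  where "P ** Q = mat 1" "Q ** P = mat 1" "Q ** A ** P = diag l" "inj l"
    "\<And>i. poly (charpoly A) (l i) = 0"
proof -
  have "finite {z. poly (charpoly A) z = 0}"
    using assms by (intro card_ge_0_finite) simp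
  then obtain l where l: "bij_betw l (UNIV :: 'n set) {z. poly (charpoly A) z = 0}"
    using assms by (metis finite finite_same_card_bij)
  have root: "poly (charpoly A) (l i) = 0" for i
    using l by (auto simp: bij_betw_def)
  have "\<forall>i. \<exists>v. v \<noteq> 0 \<and> A *v v = l i *s v"
    using root charpoly_root_iff by blast
  then obtain v where v: "\<And>i. v i \<noteq> 0" "\<And>i. A *v v i = l i *s v i"
    by metis
  define P where "P = (\<chi> i j. v j $ i)"
  have col: "column j P = v j" for j
    by (simp add: column_def P_def vec_eq_iff)
  have AP: "A ** P = P ** diag l"
  proof -
    have "(A ** P) $ i $ j = (A *v v j) $ i" for i j
      by (simp add: matrix_matrix_mult_def matrix_vector_mult_def P_def)
    then show ?thesis
      by (simp add: vec_eq_iff v diag_mult P_def)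
  qed
  have "inj l" using l by (simp add: bij_betw_def)
  with AP have "invertible P"
    by (rule eigenvector_matrix_invertible) (simp add: col v)
  then obtain Q where Q: "P ** Q = mat 1" "Q ** P = mat 1"
    by (auto simp: invertible_def)
  have "Q ** A ** P = diag l"
    by (metis AP Q(2) matrix_mul_assoc matrix_mul_lid)
  then show thesis using that Q \<open>inj l\<close> root by blast
qed

abbreviation cmat :: "int ^ 'n ^ 'm \<Rightarrow> complex ^ 'n ^ 'm" where
  "cmat \<equiv> map_matrix of_int"

lemma map_matrix_of_int_mult:
  "map_matrix of_int (A ** B) = (map_matrix of_int A ** map_matrix of_int B :: 'a::ring_1 ^ 'm ^ 'n)"
  by (simp add: vec_eq_iff matrix_matrix_mult_def)

lemma map_matrix_of_int_one: "map_matrix of_int (mat 1) = (mat 1 :: 'a::ring_1 ^ 'n ^ 'n)"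
  by (simp add: vec_eq_iff mat_def)

text \<open>Both the eigenvalue and its inverse, an eigenvalue of the inverse integer matrix, are rational
algebraic integers, so the eigenvalue is a unit of the integers.\<close>

lemma unimodular_rational_eigenvalue:
  assumes "invertible A" "v \<noteq> 0" "cmat A *v v = z *s v" "z \<in> \<rat>"
  shows "cmod z = 1"
proof -
  obtain B where B: "B ** A = mat 1" using assms by (auto simp: invertible_def)
  have "v = cmat (B ** A) *v v"
    by (simp add: B map_matrix_of_int_one)
  also have "\<dots> = z *s (cmat B *v v)"
    by (simp add: map_matrix_of_int_mult matrix_vector_mul_assoc[symmetric] assms vec.scale)
  finally have v: "v = z *s (cmat B *v v)" .
  then have "z \<noteq> 0" using assms by auto
  then have Bv: "cmat B *v v = inverse z *s v"
    by (subst (2) v) (simp add: vector_smult_assoc)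
  have "z \<in> \<int>"
    by (rule rational_eigenvalue_Ints[of "cmat A" v]) (use assms in auto)
  moreover have "inverse z \<in> \<int>"
    by (rule rational_eigenvalue_Ints[of "cmat B" v]) (use assms Bv in auto)
  ultimately obtain a b where ab: "z = of_int a" "inverse z = of_int b"
    by (auto elim!: Ints_cases)
  then have "of_int (a * b) = (1::complex)"
    using \<open>z \<noteq> 0\<close> by (metis of_int_mult right_inverse)
  then have "a * b = 1" by (metis of_int_eq_1_iff)
  then have "\<bar>a\<bar> = 1" using zmult_eq_1_iff by auto
  then show ?thesis using ab by simp
qed

text \<open>A multiple eigenvalue would be rational, hence of modulus one, which hyperbolicity forbids.\<close>

lemma hyperbolic_diagonalizable:
  fixes A :: "int ^ 'n ^ 'n"
  assumes "CARD('n) = 2 \<or> CARD('n) = 3" "invertible A"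
    and hyp: "\<And>c. complex_eigenvalue A c \<Longrightarrow> cmod c \<noteq> 1"
  obtains P Q :: "complex ^ 'n ^ 'n" and l where "P ** Q = mat 1" "Q ** P = mat 1" "Q ** cmat A ** P = diag l" "inj l"
    "\<And>i. cmod (l i) \<noteq> 1"
proof -
  let ?p = "charpoly (cmat A)"
  have ev: "cmod z \<noteq> 1" if "poly ?p z = 0" for z
    using that hyp unfolding charpoly_root_iff complex_eigenvalue_def by blast
  have deg: "degree ?p = 2 \<or> degree ?p = 3"
    by (simp only: charpoly_monic(1) assms(1))
  have "\<not> (poly ?p z = 0 \<and> poly (pderiv ?p) z = 0)" for z
  proof
    assume z: "poly ?p z = 0 \<and> poly (pderiv ?p) z = 0"
    have "coeff ?p k \<in> \<rat>" for k
      using Ints_coeff_charpoly[of "cmat A" k] Ints_subset_Rats by auto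
    then have "z \<in> \<rat>"
      using multiple_root_rational[OF deg charpoly_monic(2)] z by blast
    then have "cmod z = 1"
      using z assms(2) unimodular_rational_eigenvalue charpoly_root_iff by blast
    then show False using ev z by blast
  qed
  then have "rsquarefree ?p" by (simp add: rsquarefree_roots)
  then have eq: "?p = (\<Prod>z|poly ?p z = 0. [:-z, 1:])"
    by (metis complex_poly_decompose_rsquarefree charpoly_monic(2) smult_1_left)
  have "CARD('n) = degree (\<Prod>z|poly ?p z = 0. [:-z, 1:])"
    using charpoly_monic(1)[of "cmat A"] arg_cong[OF eq, of degree] by (rule trans[OF sym])
  also have "\<dots> = card {z. poly ?p z = 0}"
    by (simp add: degree_prod_sum_eq)
  finally have "card {z. poly ?p z = 0} = CARD('n)" ..
  then obtain P Q :: "complex ^ 'n ^ 'n" and l where "P ** Q = mat 1" "Q ** P = mat 1" "Q ** cmat A ** P = diag l" "inj l"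
    "\<And>i. poly ?p (l i) = 0"
    using diagonalizable_if_distinct_roots[of "cmat A"] by blast
  then show thesis
    using that[of P Q l] ev by blast
qed


section \<open>Lifting torus maps to Euclidean space\<close>

lemma torus_proj_cases:
  fixes p :: "'n::finite torus"
  obtains x where "p = torus_proj x"
proof -
  have "\<exists>x. p = torus_proj x"
  proof (rule torus.abs_induct[of "\<lambda>p. \<exists>x. p = torus_proj x"])
    fix y :: "real ^ 'n"
    show "\<exists>x. torus_proj y = torus_proj x" by (rule exI, rule refl)
  qed
  then show thesis using that by blast
qed

definition int_vecs :: "(real ^ 'n) set" where
  "int_vecs = {x. \<forall>i. x $ i \<in> \<int>}"

lemma torus_proj_eq_iff: "torus_proj x = torus_proj y \<longleftrightarrow> x - y \<in> int_vecs"
  by (simp add: torus.abs_eq_iff torus_rel_def int_vecs_def)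

lemma int_vecs_closed:
  "0 \<in> int_vecs" "axis j 1 \<in> int_vecs"
  "x \<in> int_vecs \<Longrightarrow> map_matrix real_of_int A *v x \<in> int_vecs"
  by (auto simp: int_vecs_def axis_def matrix_vector_mult_def intro!: Ints_sum)

text \<open>The lattice is generated as a group by the unit vectors. Typical use: the periods of a function
form a group, so periodicity along the unit vectors gives periodicity along the lattice.\<close>

lemma int_vecs_induct [consumes 1, case_names zero axis add diff]:
  assumes m: "m \<in> int_vecs" and P0: "P 0" and Pax: "\<And>j. P (axis j 1)"
    and Padd: "\<And>x y. P x \<Longrightarrow> P y \<Longrightarrow> P (x + y)" and Pdiff: "\<And>x y. P x \<Longrightarrow> P y \<Longrightarrow> P (x - y)"
  shows "P m"
proof -
  have axis: "P (of_int k *\<^sub>R axis j 1)" for k :: int and j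
  proof (induction k rule: int_induct[of _ 0])
    case (step1 i) then show ?case using Padd[OF _ Pax[of j]] by (simp add: scaleR_add_left)
  next
    case (step2 i) then show ?case using Pdiff[OF _ Pax[of j]] by (simp add: scaleR_diff_left)
  qed (simp add: P0)
  have "P (\<Sum>j\<in>S. m $ j *\<^sub>R axis j 1)" if "finite S" for S
    using that
  proof (induction S)
    case (insert j S)
    obtain k where "m $ j = of_int k"
      using m by (auto simp: int_vecs_def elim: Ints_cases)
    then show ?case using insert axis[of k j] by (simp add: Padd)
  qed (simp add: P0)
  from this[of UNIV] show ?thesis
    by (simp add: basis_expansion scalar_mult_eq_scaleR[symmetric])
qed

text \<open>Continuity of a torus map is expressed by a continuous lift, which spares a topology on the
quotient type and is visibly stable under iteration.\<close>

definition torus_lift :: "(real ^ 'n \<Rightarrow> real ^ 'n) \<Rightarrow> ('n::finite torus \<Rightarrow> 'n torus) \<Rightarrow> bool" where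
  "torus_lift G g \<longleftrightarrow> continuous_on UNIV G \<and> (\<forall>x. g (torus_proj x) = torus_proj (G x))"

text \<open>The coordinate characters \<open>exp (2 \<pi> i x\<^sub>j)\<close> separate the points of the torus and
take values in the punctured plane. They turn the lifting problem into the existence of continuous
logarithms on Euclidean space.\<close>

lift_definition torus_char :: "'n::finite torus \<Rightarrow> 'n \<Rightarrow> complex"
  is "\<lambda>x j. exp (of_real (2 * pi * x $ j) * \<i>)"
proof (rule ext)
  fix x y :: "real ^ 'n" and j
  assume "torus_rel x y"
  then have "x $ j - y $ j \<in> \<int>" by (simp add: torus_rel_def)
  then obtain n where "x $ j = y $ j + of_int n"
    by (metis Ints_cases add.commute diff_add_cancel)
  then show "exp (of_real (2 * pi * x $ j) * \<i>) = exp (of_real (2 * pi * y $ j) * \<i>)"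
    unfolding exp_eq by (intro exI[of _ n]) (simp add: algebra_simps)
qed

text \<open>The charts give continuity at some representative \<open>x'\<close> of the point; a lattice translation
carries it to the prescribed representative \<open>x\<close>.\<close>

lemma torus_C1_imp_continuous:
  fixes g :: "'n::finite torus \<Rightarrow> 'n torus"
  assumes "torus_C1 g"
  shows "continuous_on UNIV (\<lambda>x. torus_char (g (torus_proj x)) j)"
proof -
  let ?F = "\<lambda>x. torus_char (g (torus_proj x)) j"
  have "isCont ?F x" for x
  proof -
    obtain U V where U: "open U" "torus_proj x \<in> torus_proj ` U"
      and V: "g ` torus_proj ` U \<subseteq> torus_proj ` V"
      and C1: "C1_on U (inv_into V torus_proj \<circ> g \<circ> torus_proj)"
      using assms[unfolded torus_C1_def torus_C1_at_def, THEN spec, of "torus_proj x"]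
      by (elim exE conjE) (rule that)
    define s where "s = inv_into V torus_proj \<circ> g \<circ> torus_proj"
    obtain x' where x': "x' \<in> U" "torus_proj x' = torus_proj x" using U(2) by (metis imageE)
    have "isCont s x'"
      using C1 x'(1) unfolding C1_on_def s_def[symmetric] by (meson has_derivative_continuous)
    then have lifted: "isCont (\<lambda>y. exp (of_real (2 * pi * s y $ j) * \<i>)) x'"
    proof (rule isCont_o2)
      have "continuous_on UNIV (\<lambda>v :: real ^ 'n. exp (of_real (2 * pi * v $ j) * \<i>))"
        by (intro continuous_intros)
      then show "isCont (\<lambda>v :: real ^ 'n. exp (of_real (2 * pi * v $ j) * \<i>)) (s x')"
        by (simp add: continuous_on_eq_continuous_at)
    qed
    have "?F y = exp (of_real (2 * pi * s y $ j) * \<i>)" if "y \<in> U" for y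
    proof -
      have "g (torus_proj y) \<in> torus_proj ` V" using that V by blast
      then have "g (torus_proj y) = torus_proj (s y)"
        by (simp add: s_def f_inv_into_f)
      then show ?thesis by (simp add: torus_char.abs_eq)
    qed
    then have cong: "\<forall>\<^sub>F y in nhds x'. ?F y = exp (of_real (2 * pi * s y $ j) * \<i>)"
      unfolding eventually_nhds using U(1) x'(1) by blast
    have F': "isCont ?F x'"
      by (rule isCont_cong[OF cong, THEN iffD2, OF lifted])
    have shift: "torus_proj (y + (x' - x)) = torus_proj y" for y
      using x' by (simp add: torus_proj_eq_iff)
    have "isCont (\<lambda>y. ?F (y + (x' - x))) x"
    proof (rule isCont_o2[where g = ?F])
      show "isCont ?F (x + (x' - x))" using F' by simp
    qed (intro continuous_intros)
    then show ?thesis by (simp add: shift)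
  qed
  then show ?thesis by (simp add: continuous_at_imp_continuous_on)
qed

text \<open>Each character of \<open>g\<close> has a continuous logarithm because Euclidean space is contractible; the
imaginary parts of these logarithms, rescaled, are the coordinates of the lift.\<close>

lemma torus_C1_lift:
  fixes g :: "'n::finite torus \<Rightarrow> 'n torus"
  assumes "torus_C1 g"
  obtains G where "torus_lift G g"
proof -
  have "torus_char p j \<noteq> 0" for p :: "'n torus" and j
    by (rule torus_proj_cases[of p]) (simp add: torus_char.abs_eq)
  then have nz: "torus_char (g (torus_proj x)) j \<noteq> 0" for x j .
  have "\<exists>h. continuous_on UNIV h \<and> (\<forall>x. torus_char (g (torus_proj x)) j = exp (h x))" for j
  proof -
    obtain h where "continuous_on UNIV h" "\<And>x. x \<in> UNIV \<Longrightarrow> torus_char (g (torus_proj x)) j = exp (h x)"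
      using continuous_logarithm_on_contractible[OF torus_C1_imp_continuous[OF assms, of j]
          contractible_UNIV nz] by blast
    then show ?thesis by (intro exI[of _ h]) simp
  qed
  then obtain h where h: "\<And>j. continuous_on UNIV (h j)"
    "\<And>j x. torus_char (g (torus_proj x)) j = exp (h j x)" by metis
  define G where "G = (\<lambda>x. \<chi> j. Im (h j x) / (2 * pi))"
  have "g (torus_proj x) = torus_proj (G x)" for x
  proof (rule torus_proj_cases[of "g (torus_proj x)"])
    fix y assume y: "g (torus_proj x) = torus_proj y"
    have "y $ j - G x $ j \<in> \<int>" for j
    proof -
      have "exp (of_real (2 * pi * y $ j) * \<i>) = exp (h j x)"
        using h(2)[of x j] by (simp add: y torus_char.abs_eq)
      then obtain n :: int where "of_real (2 * pi * y $ j) * \<i> = h j x + (of_int (2 * n) * pi) * \<i>"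
        unfolding exp_eq by blast
      from arg_cong[OF this, of Im] have "2 * pi * y $ j = Im (h j x) + 2 * n * pi"
        by simp
      then have "y $ j - G x $ j = of_int n"
        by (simp add: G_def field_simps)
      then show ?thesis by simp
    qed
    then show ?thesis by (simp add: y torus_proj_eq_iff int_vecs_def)
  qed
  moreover have "continuous_on UNIV G"
    unfolding G_def by (intro continuous_on_vec_lambda continuous_on_divide continuous_on_Im h continuous_on_const) simp
  ultimately have "torus_lift G g"
    by (simp only: torus_lift_def simp_thms)
  then show thesis by (rule that)
qed

lemma torus_lift_funpow:
  assumes "torus_lift G g"
  shows "torus_lift (G ^^ k) (g ^^ k)"
proof (induction k)
  case (Suc k)
  then have "continuous_on UNIV (G ^^ k)" and G: "continuous_on UNIV G"
    using assms by (simp_all only: torus_lift_def)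
  then have "continuous_on UNIV (G \<circ> G ^^ k)"
    using continuous_on_compose continuous_on_subset[OF G subset_UNIV] by blast
  then show ?case
    using Suc assms by (simp add: torus_lift_def)
qed (simp add: torus_lift_def continuous_on_id)

lemma continuous_int_vecs_constant:
  fixes F :: "real ^ 'n \<Rightarrow> real ^ 'm"
  assumes "continuous_on UNIV F" "\<And>x. F x \<in> int_vecs"
  shows "F x = F y"
proof -
  have "(\<lambda>x. F x $ i) constant_on UNIV" for i
  proof (rule continuous_discrete_range_constant)
    show "continuous_on UNIV (\<lambda>x. F x $ i)" using assms by (intro continuous_intros)
    fix x
    have "1 \<le> norm (F y $ i - F x $ i)" if "F y $ i \<noteq> F x $ i" for y
    proof -
      have "F y $ i - F x $ i \<in> \<int>" using assms(2) by (simp add: int_vecs_def)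
      then show ?thesis using that Ints_nonzero_abs_ge1 by fastforce
    qed
    then show "\<exists>e>0. \<forall>y. y \<in> UNIV \<and> F y $ i \<noteq> F x $ i \<longrightarrow> e \<le> norm (F y $ i - F x $ i)"
      by (intro exI[of _ 1]) auto
  qed (rule connected_UNIV)
  then have "F x $ i = F y $ i" for i
    unfolding constant_on_def by (metis UNIV_I)
  then show ?thesis by (simp add: vec_eq_iff)
qed

lemma int_floor_decomposition:
  fixes x :: "real ^ 'n"
  obtains y m where "y \<in> cbox 0 (\<chi> i. 1)" "m \<in> int_vecs" "x = y + m"
proof
  show "(\<chi> i. frac (x $ i)) \<in> cbox 0 (\<chi> i. 1)"
    by (simp add: mem_box_cart frac_ge_0 less_imp_le[OF frac_lt_1])
  show "(\<chi> i. of_int \<lfloor>x $ i\<rfloor>) \<in> int_vecs" by (simp add: int_vecs_def)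
  show "x = (\<chi> i. frac (x $ i)) + (\<chi> i. of_int \<lfloor>x $ i\<rfloor>)"
    by (simp add: vec_eq_iff frac_def)
qed

lemma periodic_bounded:
  fixes u :: "real ^ 'n \<Rightarrow> real ^ 'm"
  assumes "continuous_on UNIV u" "\<And>x m. m \<in> int_vecs \<Longrightarrow> u (x + m) = u x"
  shows "bounded (range u)"
proof -
  have "range u \<subseteq> u ` cbox 0 (\<chi> i. 1)"
  proof safe
    fix x :: "real ^ 'n"
    obtain y m where "y \<in> cbox 0 (\<chi> i. 1)" "m \<in> int_vecs" "x = y + m"
      by (rule int_floor_decomposition)
    then show "u x \<in> u ` cbox 0 (\<chi> i. 1)" using assms(2)[of m y] by blast
  qed
  moreover have "bounded (u ` cbox 0 (\<chi> i. 1))"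
    using assms(1) by (meson compact_cbox compact_continuous_image compact_imp_bounded
        continuous_on_subset subset_UNIV)
  ultimately show ?thesis using bounded_subset by blast
qed

text \<open>The increment of \<open>G\<close> along a lattice vector is continuous and lattice valued, hence constant, so
the increments define a homomorphism of the lattice: the action of the torus map on the
fundamental group.\<close>

lemma quasi_periodic_linear_part:
  fixes G :: "real ^ 'n \<Rightarrow> real ^ 'n"
  assumes "continuous_on UNIV G" and per: "\<And>x m. m \<in> int_vecs \<Longrightarrow> G (x + m) - G x \<in> int_vecs"
  obtains B :: "int ^ 'n ^ 'n" where
    "\<And>x m. m \<in> int_vecs \<Longrightarrow> G (x + m) = G x + map_matrix real_of_int B *v m"
proof -
  define B :: "int ^ 'n ^ 'n" where "B = (\<chi> i j. \<lfloor>(G (0 + axis j 1) - G 0) $ i\<rfloor>)"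
  let ?B = "map_matrix real_of_int B"
  have const: "G (x + m) - G x = G (0 + m) - G 0" if "m \<in> int_vecs" for m x
  proof (rule continuous_int_vecs_constant[where F = "\<lambda>x. G (x + m) - G x"])
    show "continuous_on UNIV (\<lambda>x. G (x + m) - G x)"
      by (intro continuous_on_diff continuous_on_compose2[OF assms(1)] assms(1)
          continuous_on_add continuous_on_id continuous_on_const subset_UNIV)
    show "G (x + m) - G x \<in> int_vecs" for x using that by (rule per)
  qed
  have B: "?B *v axis j 1 = G (0 + axis j 1) - G 0" for j
  proof -
    have "(G (0 + axis j 1) - G 0) $ i \<in> \<int>" for i
      using per[OF int_vecs_closed(2)[of j], of 0] by (simp add: int_vecs_def)
    then have "of_int \<lfloor>(G (0 + axis j 1) - G 0) $ i\<rfloor> = (G (0 + axis j 1) - G 0) $ i" for i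
      by (metis Ints_cases floor_of_int)
    then show ?thesis
      unfolding matrix_vector_mult_basis column_def B_def by (simp add: vec_eq_iff)
  qed
  have "\<forall>x. G (x + m) = G x + ?B *v m" if "m \<in> int_vecs" for m
    using that
  proof (induction m rule: int_vecs_induct)
    case (axis j)
    show ?case
    proof
      fix x
      have "G (x + axis j 1) - G x = ?B *v axis j 1"
        unfolding B by (rule const[OF int_vecs_closed(2)])
      then show "G (x + axis j 1) = G x + ?B *v axis j 1"
        by (metis add.commute diff_eq_eq)
    qed
  next
    case (add m m')
    show ?case
    proof
      fix x
      have "G (x + (m + m')) = G (x + m) + ?B *v m'"
        using add.IH(2)[THEN spec, of "x + m"] by (simp only: add.assoc)
      then show "G (x + (m + m')) = G x + ?B *v (m + m')"
        unfolding add.IH(1)[THEN spec, of x] matrix_vector_right_distrib by simp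
    qed
  next
    case (diff m m')
    show ?case
    proof
      fix x
      have "G (x + m) = G (x + (m - m')) + ?B *v m'"
        using diff.IH(2)[THEN spec, of "x + (m - m')"] by simp
      then show "G (x + (m - m')) = G x + ?B *v (m - m')"
        unfolding diff.IH(1)[THEN spec, of x] matrix_vector_mult_diff_distrib
        by (metis add_diff_eq add_diff_cancel_right')
    qed
  qed simp
  then show thesis by (intro that) blast
qed

lemma toral_endo_mult:
  fixes A B :: "int ^ 'n ^ 'n::finite"
  shows "toral_endo (A ** B) = toral_endo A \<circ> toral_endo B"
proof
  fix p :: "'n torus"
  obtain x where p: "p = torus_proj x" by (rule torus_proj_cases)
  show "toral_endo (A ** B) p = (toral_endo A \<circ> toral_endo B) p"
    by (simp add: p toral_endo.abs_eq matrix_vector_mul_assoc map_matrix_of_int_mult)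
qed

lemma toral_endo_one: "toral_endo (mat 1) = (id :: 'n::finite torus \<Rightarrow> 'n torus)"
proof
  fix p :: "'n torus"
  obtain x where p: "p = torus_proj x" by (rule torus_proj_cases)
  show "toral_endo (mat 1) p = id p"
    by (simp add: p toral_endo.abs_eq map_matrix_of_int_one)
qed

text \<open>The difference of the two linear lifts is continuous and lattice valued, hence constant, and it
vanishes at the origin.\<close>

lemma toral_endo_inject: "toral_endo A = toral_endo B \<longleftrightarrow> A = B"
proof
  assume eq: "toral_endo A = toral_endo B"
  have mem: "map_matrix real_of_int A *v x - map_matrix real_of_int B *v x \<in> int_vecs" for x
    using fun_cong[OF eq, of "torus_proj x"] by (simp add: toral_endo.abs_eq torus_proj_eq_iff)
  let ?D = "\<lambda>x. map_matrix real_of_int A *v x - map_matrix real_of_int B *v x"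
  have "continuous_on UNIV ?D"
    by (intro continuous_on_diff matrix_vector_mult_linear_continuous_on)
  then have "?D x = ?D 0" for x
    by (rule continuous_int_vecs_constant[where F = ?D]) (rule mem)
  then have const: "?D x = 0" for x by simp
  have "map_matrix real_of_int A = map_matrix real_of_int B"
    unfolding matrix_eq using const by simp
  then show "A = B" by (simp add: vec_eq_iff)
qed simp

lemma finite_vec_entries:
  assumes "finite S"
  shows "finite {v :: 'a ^ 'n. \<forall>i. v $ i \<in> S}"
proof -
  have "{v :: 'a ^ 'n. \<forall>i. v $ i \<in> S} \<subseteq> vec_lambda ` (UNIV \<rightarrow>\<^sub>E S)"
  proof
    fix v :: "'a ^ 'n" assume "v \<in> {v. \<forall>i. v $ i \<in> S}"
    then show "v \<in> vec_lambda ` (UNIV \<rightarrow>\<^sub>E S)"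
      by (intro image_eqI[of _ _ "vec_nth v"]) auto
  qed
  then show ?thesis by (rule finite_subset) (simp add: finite_PiE assms)
qed

lemma finite_bounded_int_vecs:
  assumes "bounded (S :: (real ^ 'n) set)" "S \<subseteq> int_vecs"
  shows "finite S"
proof -
  obtain M where M: "\<And>v. v \<in> S \<Longrightarrow> norm v \<le> M" using assms(1) by (auto simp: bounded_iff)
  have "v $ i \<in> of_int ` {- \<lceil>M\<rceil>..\<lceil>M\<rceil>}" if v: "v \<in> S" for v i
  proof -
    have "v $ i \<in> \<int>" using assms(2) v by (auto simp: int_vecs_def)
    then obtain k where k: "v $ i = of_int k" by (rule Ints_cases)
    have "\<bar>v $ i\<bar> \<le> M" using component_le_norm_cart[of v i] M[OF v] by linarith
    then have "\<bar>k\<bar> \<le> \<lceil>M\<rceil>" unfolding k by linarith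
    then have "k \<in> {- \<lceil>M\<rceil>..\<lceil>M\<rceil>}" by auto
    then show ?thesis using k by blast
  qed
  then have "S \<subseteq> {v. \<forall>i. v $ i \<in> of_int ` {- \<lceil>M\<rceil>..\<lceil>M\<rceil>}}" by blast
  then show ?thesis by (rule finite_subset) (intro finite_vec_entries finite_imageI finite_atLeastAtMost_int)
qed

text \<open>A fixed point has a representative \<open>x\<close> in the unit cube for which \<open>A x - x\<close> is a lattice vector.
Only finitely many lattice vectors are close enough to the origin, and each comes from at most one
\<open>x\<close>.\<close>

lemma finite_toral_endo_fixed_points:
  fixes A :: "int ^ 'n ^ 'n"
  assumes "\<And>v. map_matrix real_of_int A *v v = v \<Longrightarrow> v = 0"
  shows "finite {p. toral_endo A p = p}"
proof -
  let ?T = "\<lambda>x. map_matrix real_of_int A *v x - x"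
  let ?X = "{x \<in> cbox 0 (\<chi> i. 1). ?T x \<in> int_vecs}"
  have lin: "linear ?T" by (intro linear_compose_sub matrix_vector_mul_linear linear_id[unfolded id_def])
  then have "bounded (?T ` cbox 0 (\<chi> i. 1))"
    by (intro compact_imp_bounded compact_continuous_image linear_continuous_on compact_cbox
        linear_conv_bounded_linear[THEN iffD1])
  then have "bounded (?T ` ?X)" by (rule bounded_subset) blast
  then have fin: "finite (?T ` ?X)" by (rule finite_bounded_int_vecs) blast
  have "inj ?T"
    unfolding linear_injective_0[OF lin] using assms by simp
  then have "inj_on ?T ?X" by (rule inj_on_subset) simp
  with fin have "finite ?X" by (rule finite_imageD)
  moreover have "{p. toral_endo A p = p} \<subseteq> torus_proj ` ?X"
  proof
    fix p assume "p \<in> {p. toral_endo A p = p}"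
    then have p: "toral_endo A p = p" by simp
    obtain x where x: "p = torus_proj x" by (rule torus_proj_cases)
    obtain y m where ym: "y \<in> cbox 0 (\<chi> i. 1)" "m \<in> int_vecs" "x = y + m"
      by (rule int_floor_decomposition)
    have py: "p = torus_proj y" using x ym by (simp add: torus_proj_eq_iff)
    then have "?T y \<in> int_vecs"
      using p by (simp add: toral_endo.abs_eq torus_proj_eq_iff)
    then show "p \<in> torus_proj ` ?X" using py ym by blast
  qed
  ultimately show ?thesis by (meson finite_imageI finite_subset)
qed


section \<open>Maps commuting with a hyperbolic automorphism are linear\<close>

text \<open>If \<open>\<bar>l\<bar> > 1\<close>, forward iteration would make a nonzero value grow without bound; if
\<open>\<bar>l\<bar> < 1\<close>, backward iteration would.\<close>

lemma bounded_multiplier_orbit_zero: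
  fixes z :: "'a \<Rightarrow> complex"
  assumes step: "\<And>x. z (T x) = l * z x" and "surj T" and "cmod l \<noteq> 1"
    and bound: "\<And>x. cmod (z x) \<le> M"
  shows "z x = 0"
proof (rule ccontr)
  assume nz: "z x \<noteq> 0"
  have pow: "z ((T ^^ k) y) = l ^ k * z y" for k y
    by (induction k) (simp_all add: step)
  show False
  proof (cases "cmod l > 1")
    case True
    then obtain k where k: "M / cmod (z x) < cmod l ^ k"
      using real_arch_pow by blast
    have "cmod l ^ k * cmod (z x) \<le> M"
      using bound[of "(T ^^ k) x"] by (simp add: pow norm_mult norm_power)
    then show False using k nz by (simp add: divide_less_eq)
  next
    case False
    then have "cmod l < 1" using assms(3) by simp
    have M: "M > 0" using bound[of x] nz by (meson norm_ge_zero not_less order_trans zero_less_norm_iff less_le_trans)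
    then obtain k where k: "cmod l ^ k < cmod (z x) / M"
      using real_arch_pow_inv[of "cmod (z x) / M" "cmod l"] \<open>cmod l < 1\<close> nz by auto
    have "surj (T ^^ k)" by (rule surj_fn[OF \<open>surj T\<close>])
    then obtain y where "x = (T ^^ k) y" by blast
    then have "cmod (z x) = cmod l ^ k * cmod (z y)"
      by (simp add: pow norm_mult norm_power)
    also have "\<dots> \<le> cmod l ^ k * M"
      by (intro mult_left_mono bound) simp
    also have "\<dots> < cmod (z x)"
      using k M by (simp add: less_divide_eq)
    finally show False by simp
  qed
qed

text \<open>The columns of \<open>P\<close> are complex eigenvectors of the integer matrix \<open>A\<close>, and \<open>Q\<close> is the inverse
of \<open>P\<close>. Distinct eigenvalues force every matrix commuting with \<open>A\<close> to be diagonal in the same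
basis; eigenvalues off the unit circle express hyperbolicity.\<close>

locale hyperbolic_eigenbasis =
  fixes A :: "int ^ 'n ^ 'n" and P Q :: "complex ^ 'n ^ 'n" and l :: "'n \<Rightarrow> complex"
  assumes unimodular: "invertible A"
    and PQ: "P ** Q = mat 1" and QP: "Q ** P = mat 1"
    and diagonalized: "Q ** cmat A ** P = diag l"
    and distinct: "inj l" and hyperbolic: "\<And>i. cmod (l i) \<noteq> 1"
begin

abbreviation "Ar \<equiv> map_matrix real_of_int A"

lemma surj_Ar: "surj ((*v) Ar)"
proof -
  obtain A' where "A ** A' = mat 1" using unimodular by (auto simp: invertible_def)
  then have "Ar ** map_matrix real_of_int A' = mat 1"
    by (metis map_matrix_of_int_mult map_matrix_of_int_one)
  then show ?thesis by (metis matrix_right_invertible_surjective)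
qed

text \<open>In eigencoordinates the equivariant map splits into scalar functions multiplied by an eigenvalue
along orbits of \<open>A\<close>, and each of them is bounded.\<close>

lemma bounded_equivariant_zero:
  fixes u :: "real ^ 'n \<Rightarrow> real ^ 'n"
  assumes bnd: "bounded (range u)" and eq: "\<And>x. u (Ar *v x) = Ar *v u x"
  shows "u x = 0"
proof -
  define c where "c = (\<lambda>v :: real ^ 'n. \<chi> i. complex_of_real (v $ i))"
  define y where "y = (\<lambda>x. Q *v c (u x))"
  obtain K where K: "\<And>x. norm (u x) \<le> K"
    using bnd by (auto simp: bounded_iff)
  have cA: "c (Ar *v v) = cmat A *v c v" for v
    by (simp add: c_def vec_eq_iff matrix_vector_mult_def)
  \<comment> \<open>\<open>y\<close> collects the eigencoordinates of \<open>u\<close>.\<close>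
  have "y (Ar *v x) = diag l *v y x" for x
    by (simp add: y_def eq cA diagonalized[symmetric] matrix_vector_mul_assoc
        matrix_mul_assoc[symmetric] PQ)
  then have step: "y (Ar *v x) $ i = l i * y x $ i" for x i
    by (simp add: diag_vec)
  have "cmod (y x $ i) \<le> (\<Sum>j\<in>UNIV. cmod (Q $ i $ j) * K)" for x i
  proof -
    have "\<bar>u x $ j\<bar> \<le> K" for j
      using K[of x] component_le_norm_cart[of "u x" j] by linarith
    then have "cmod (Q $ i $ j * c (u x) $ j) \<le> cmod (Q $ i $ j) * K" for j
      by (simp add: c_def norm_mult mult_left_mono)
    then show ?thesis
      unfolding y_def matrix_vector_mult_def by (simp add: sum_norm_le)
  qed
  then have "y x $ i = 0" for i
    using bounded_multiplier_orbit_zero[of "\<lambda>x. y x $ i", OF step surj_Ar hyperbolic] by blast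
  then have "Q *v c (u x) = 0" by (simp add: y_def vec_eq_iff)
  then have "P *v (Q *v c (u x)) = 0" by simp
  then have "c (u x) = 0" by (simp add: matrix_vector_mul_assoc PQ)
  then show ?thesis by (simp add: c_def vec_eq_iff)
qed

lemma fixed_vector_zero: "Ar *v v = v \<Longrightarrow> v = 0"
  using bounded_equivariant_zero[of "\<lambda>_. v"] by simp

text \<open>Let \<open>H\<close> be the lift of \<open>g\<close> that fixes the origin and \<open>B\<close> its linear part. Commutation
with \<open>A\<close> holds for the lifts as well, the defect being a lattice valued continuous function that
vanishes at the origin. The deviation \<open>u = H - B\<close> is periodic, hence bounded, and equivariant
under \<open>A\<close>, so hyperbolicity forces it to vanish.\<close>

lemma commuting_lift_linear:
  assumes lift: "torus_lift G g" and comm: "g \<circ> toral_endo A = toral_endo A \<circ> g"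
    and fix0: "g (torus_proj 0) = torus_proj 0"
  obtains B where "g = toral_endo B"
proof -
  define H where "H = (\<lambda>x. G x - G 0)"
  have contG: "continuous_on UNIV G" and gG: "\<And>x. g (torus_proj x) = torus_proj (G x)"
    using lift by (auto simp: torus_lift_def)
  have contH: "continuous_on UNIV H"
    unfolding H_def by (intro continuous_intros contG)
  have "G 0 \<in> int_vecs"
    using fix0 unfolding gG torus_proj_eq_iff by simp
  then have gH: "g (torus_proj x) = torus_proj (H x)" for x
    unfolding gG torus_proj_eq_iff H_def by simp
  have H0: "H 0 = 0" by (simp add: H_def)
  have "H (x + m) - H x \<in> int_vecs" if "m \<in> int_vecs" for x m
  proof -
    have "torus_proj (x + m) = torus_proj x"
      unfolding torus_proj_eq_iff using that by simp
    then show ?thesis by (metis gH torus_proj_eq_iff)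
  qed
  then obtain B :: "int ^ 'n ^ 'n" where
    B: "\<And>x m. m \<in> int_vecs \<Longrightarrow> H (x + m) = H x + map_matrix real_of_int B *v m"
    using quasi_periodic_linear_part[OF contH] by blast
  let ?B = "map_matrix real_of_int B"
  have HA: "H (Ar *v x) = Ar *v H x" for x
  proof -
    let ?D = "\<lambda>x. H (Ar *v x) - Ar *v H x"
    have "?D x \<in> int_vecs" for x
      using fun_cong[OF comm, of "torus_proj x"]
      by (simp add: toral_endo.abs_eq gH torus_proj_eq_iff)
    moreover have "continuous_on UNIV ?D"
      using continuous_on_compose2[OF contH matrix_vector_mult_linear_continuous_on subset_UNIV]
        continuous_on_compose2[OF matrix_vector_mult_linear_continuous_on contH subset_UNIV]
      by (rule continuous_on_diff)
    ultimately have "?D x = ?D 0"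
      by (intro continuous_int_vecs_constant[where F = ?D])
    then show ?thesis by (simp add: H0)
  qed
  have Hm: "H m = ?B *v m" if "m \<in> int_vecs" for m
    using B[OF that, of 0] by (simp add: H0)
  \<comment> \<open>On lattice vectors \<open>H\<close> agrees with \<open>B\<close>, so \<open>A\<close> and \<open>B\<close> commute there and hence everywhere.\<close>
  have "Ar *v (?B *v axis j 1) = ?B *v (Ar *v axis j 1)" for j
    using HA[of "axis j 1"] Hm[OF int_vecs_closed(2)] Hm[OF int_vecs_closed(3)[OF int_vecs_closed(2)]]
    by metis
  then have "column j (Ar ** ?B) = column j (?B ** Ar)" for j
    by (simp only: matrix_vector_mult_axis_column[symmetric] matrix_vector_mul_assoc[symmetric])
  then have AB: "Ar ** ?B = ?B ** Ar"
    by (simp add: column_def vec_eq_iff)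
  define u where "u = (\<lambda>x. H x - ?B *v x)"
  have "bounded (range u)"
  proof (rule periodic_bounded)
    show "continuous_on UNIV u"
      unfolding u_def by (intro continuous_on_diff contH matrix_vector_mult_linear_continuous_on)
    show "u (x + m) = u x" if "m \<in> int_vecs" for x m
      by (simp add: u_def B[OF that] matrix_vector_right_distrib)
  qed
  moreover have "u (Ar *v x) = Ar *v u x" for x
    by (simp add: u_def HA matrix_vector_mult_diff_distrib matrix_vector_mul_assoc AB)
  ultimately have "u x = 0" for x by (rule bounded_equivariant_zero)
  then have HB: "H x = ?B *v x" for x by (simp add: u_def)
  have "g p = toral_endo B p" for p
    by (rule torus_proj_cases[of p]) (simp add: gH HB toral_endo.abs_eq)
  then have "g = toral_endo B" by (rule ext)
  then show thesis by (rule that)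
qed

end


section \<open>Counting units in logarithmic boxes\<close>

lemma det_of_int_matrix: "det (map_matrix of_int X :: 'a::comm_ring_1 ^ 'n ^ 'n) = of_int (det X)"
  by (simp add: det_def)

lemma card_le_fibres:
  assumes "finite T" "\<phi> ` S \<subseteq> T"
    and fin: "\<And>t. t \<in> T \<Longrightarrow> finite {s \<in> S. \<phi> s = t} \<and> card {s \<in> S. \<phi> s = t} \<le> c"
  shows "finite S \<and> card S \<le> c * card T"
proof -
  have S: "S = (\<Union>t\<in>T. {s \<in> S. \<phi> s = t})" using assms(2) by blast
  have "finite (\<Union>t\<in>T. {s \<in> S. \<phi> s = t})" using assms(1) fin by blast
  moreover have "card (\<Union>t\<in>T. {s \<in> S. \<phi> s = t}) \<le> (\<Sum>t\<in>T. card {s \<in> S. \<phi> s = t})"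
    by (rule card_UN_le[OF assms(1)])
  moreover have "(\<Sum>t\<in>T. card {s \<in> S. \<phi> s = t}) \<le> (\<Sum>t\<in>T. c)"
    by (rule sum_mono) (use fin in blast)
  ultimately show ?thesis
    unfolding S[symmetric] by (simp add: mult.commute)
qed

context hyperbolic_eigenbasis
begin

text \<open>The unit group of the ring of integer matrices commuting with \<open>A\<close>. For an irreducible
characteristic polynomial this is the unit group of an order in a number field, and
\<open>log_size\<close> below is its logarithmic embedding.\<close>

definition units :: "(int ^ 'n ^ 'n) set" where
  "units = {X. A ** X = X ** A \<and> invertible X}"

definition eig :: "int ^ 'n ^ 'n \<Rightarrow> 'n \<Rightarrow> complex" where
  "eig X i = (Q ** cmat X ** P) $ i $ i"

definition log_size :: "int ^ 'n ^ 'n \<Rightarrow> 'n \<Rightarrow> real" where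
  "log_size X i = ln (cmod (eig X i))"

text \<open>A matrix that commutes with a diagonal matrix with distinct entries is itself diagonal.\<close>

lemma cmat_commuting:
  assumes "A ** X = X ** A"
  shows "cmat X = P ** diag (eig X) ** Q"
proof -
  let ?M = "Q ** cmat X ** P"
  have "diag l ** ?M = Q ** cmat A ** (P ** Q) ** cmat X ** P"
    by (simp add: diagonalized[symmetric] matrix_mul_assoc)
  also have "\<dots> = Q ** cmat (A ** X) ** P"
    by (simp add: PQ map_matrix_of_int_mult matrix_mul_assoc)
  also have "\<dots> = Q ** cmat X ** cmat A ** P"
    by (simp add: assms map_matrix_of_int_mult matrix_mul_assoc)
  also have "\<dots> = Q ** cmat X ** (P ** Q) ** cmat A ** P"
    by (simp add: PQ)
  also have "\<dots> = ?M ** diag l"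
    by (simp add: diagonalized[symmetric] matrix_mul_assoc)
  finally have comm: "diag l ** ?M = ?M ** diag l" .
  have "?M $ i $ j = 0" if "i \<noteq> j" for i j
  proof -
    have "l i * ?M $ i $ j = ?M $ i $ j * l j"
      using arg_cong[OF comm, of "\<lambda>M. M $ i $ j"] by (simp only: diag_mult)
    then have "(l i - l j) * ?M $ i $ j = 0" by (simp add: algebra_simps)
    then show ?thesis using distinct that by (simp add: inj_eq)
  qed
  then have "?M = diag (eig X)"
    by (simp add: vec_eq_iff diag_def eig_def)
  then have "P ** diag (eig X) ** Q = (P ** Q) ** cmat X ** (P ** Q)"
    by (metis matrix_mul_assoc)
  then show ?thesis by (simp add: PQ)
qed

lemma eig_mult:
  assumes "A ** X = X ** A" "A ** Y = Y ** A"
  shows "eig (X ** Y) i = eig X i * eig Y i"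
proof -
  have "Q ** cmat (X ** Y) ** P
      = (Q ** P) ** diag (eig X) ** (Q ** P) ** diag (eig Y) ** (Q ** P)"
    by (simp only: map_matrix_of_int_mult cmat_commuting[OF assms(1)] cmat_commuting[OF assms(2)]
        matrix_mul_assoc)
  also have "\<dots> = diag (eig X) ** diag (eig Y)" by (simp add: QP)
  finally show ?thesis
    unfolding eig_def[of "X ** Y"] by (simp add: diag_mult) (simp add: diag_def)
qed

lemma eig_one: "eig (mat 1) i = 1"
  by (simp add: eig_def map_matrix_of_int_one QP) (simp add: mat_def)

lemma units_one: "mat 1 \<in> units"
  by (auto simp: units_def invertible_def)

lemma units_mult: "X \<in> units \<Longrightarrow> Y \<in> units \<Longrightarrow> X ** Y \<in> units"
  unfolding units_def by (simp add: invertible_mult) (metis matrix_mul_assoc)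

lemma units_inverse:
  assumes "X \<in> units"
  obtains Y where "Y \<in> units" "X ** Y = mat 1" "Y ** X = mat 1"
proof -
  have AX: "A ** X = X ** A" using assms by (simp add: units_def)
  obtain Y where Y: "X ** Y = mat 1" "Y ** X = mat 1"
    using assms by (auto simp: units_def invertible_def)
  have "A ** Y = Y ** (X ** A) ** Y"
    by (simp add: Y matrix_mul_assoc)
  also have "\<dots> = Y ** A ** (X ** Y)"
    by (simp only: AX[symmetric] matrix_mul_assoc)
  finally have "A ** Y = Y ** A" by (simp add: Y)
  moreover have "invertible Y" using Y by (auto simp: invertible_def)
  ultimately show thesis using that Y by (simp add: units_def)
qed

lemma eig_nonzero:
  assumes "X \<in> units"
  shows "eig X i \<noteq> 0"
proof -
  obtain Y where Y: "Y \<in> units" "X ** Y = mat 1" using units_inverse[OF assms] by blast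
  have "eig X i * eig Y i = 1"
    using eig_mult[of X Y i] assms Y by (simp add: units_def eig_one)
  then show ?thesis by auto
qed

lemma log_size_mult:
  assumes "X \<in> units" "Y \<in> units"
  shows "log_size (X ** Y) i = log_size X i + log_size Y i"
proof -
  have "eig (X ** Y) i = eig X i * eig Y i"
    using assms by (intro eig_mult) (auto simp: units_def)
  then show ?thesis
    using eig_nonzero[OF assms(1)] eig_nonzero[OF assms(2)]
    by (simp add: log_size_def norm_mult ln_mult)
qed

lemma log_size_one: "log_size (mat 1) i = 0"
  by (simp add: log_size_def eig_one)

text \<open>The product of the eigenvalues is the determinant, which is a unit of the integers. The
logarithmic image therefore lies in a hyperplane, and this loss of one dimension is what makes the
counting argument succeed.\<close>

lemma sum_log_size:
  assumes "X \<in> units"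
  shows "(\<Sum>i\<in>UNIV. log_size X i) = 0"
proof -
  obtain Y where Y: "X ** Y = mat 1" using assms by (auto simp: units_def invertible_def)
  have "det X * det Y = 1" using Y by (metis det_I det_mul)
  then have "\<bar>det X\<bar> = 1" using zmult_eq_1_iff by auto
  then have "cmod (det (cmat X)) = 1"
    by (simp add: det_of_int_matrix flip: of_int_abs)
  have "det P * det Q = 1" by (metis PQ det_I det_mul)
  have "det (cmat X) = det P * det (diag (eig X)) * det Q"
    using assms by (subst cmat_commuting) (auto simp: units_def det_mul)
  also have "\<dots> = det (diag (eig X))"
    using \<open>det P * det Q = 1\<close> by (simp add: mult.commute mult.left_commute)
  also have "\<dots> = (\<Prod>i\<in>UNIV. eig X i)"
    by (subst det_diagonal) (simp_all add: diag_def)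
  finally have "(\<Prod>i\<in>UNIV. cmod (eig X i)) = 1"
    using \<open>cmod (det (cmat X)) = 1\<close> by (simp add: prod_norm)
  then have "ln (\<Prod>i\<in>UNIV. cmod (eig X i)) = 0" by simp
  moreover have "ln (\<Prod>i\<in>UNIV. cmod (eig X i)) = (\<Sum>i\<in>UNIV. log_size X i)"
    unfolding log_size_def by (rule ln_prod) (use eig_nonzero[OF assms] in auto)
  ultimately show ?thesis by simp
qed

text \<open>Bounded eigenvalues bound the entries of \<open>P ** diag (eig X) ** Q\<close>, and these entries are
integers: the logarithmic image is discrete.\<close>

lemma finite_bounded_units: "finite {X \<in> units. \<forall>i. log_size X i \<le> M}"
proof -
  define C where "C = (\<Sum>a\<in>UNIV. \<Sum>b\<in>UNIV. \<Sum>k\<in>UNIV. cmod (P $ a $ k) * exp M * cmod (Q $ k $ b))"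
  have "X $ a $ b \<in> {- \<lceil>C\<rceil>..\<lceil>C\<rceil>}" if X: "X \<in> units" "\<forall>i. log_size X i \<le> M" for X a b
  proof -
    have eig: "cmod (eig X k) \<le> exp M" for k
    proof -
      have "cmod (eig X k) = exp (log_size X k)"
        using eig_nonzero[OF X(1)] by (simp add: log_size_def)
      then show ?thesis using X(2) by simp
    qed
    have "(P ** diag (eig X) ** Q) $ a $ b = (\<Sum>k\<in>UNIV. P $ a $ k * eig X k * Q $ k $ b)"
      unfolding matrix_matrix_mult_def[of _ Q] by (simp add: diag_mult)
    then have "of_int (X $ a $ b) = (\<Sum>k\<in>UNIV. P $ a $ k * eig X k * Q $ k $ b)"
      using cmat_commuting[of X] X(1) by (simp add: units_def) (metis nth_map_matrix)
    then have "real_of_int \<bar>X $ a $ b\<bar> = cmod (\<Sum>k\<in>UNIV. P $ a $ k * eig X k * Q $ k $ b)"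
      by (metis norm_of_int of_int_abs)
    also have "\<dots> \<le> (\<Sum>k\<in>UNIV. cmod (P $ a $ k) * exp M * cmod (Q $ k $ b))"
      by (rule sum_norm_le) (simp add: norm_mult mult_left_mono mult_right_mono eig)
    also have "\<dots> \<le> (\<Sum>b\<in>UNIV. \<Sum>k\<in>UNIV. cmod (P $ a $ k) * exp M * cmod (Q $ k $ b))"
      by (rule member_le_sum[of b UNIV]) (auto intro!: sum_nonneg)
    also have "\<dots> \<le> C"
      unfolding C_def by (rule member_le_sum[of a UNIV]) (auto intro!: sum_nonneg)
    finally have "\<bar>X $ a $ b\<bar> \<le> \<lceil>C\<rceil>" by linarith
    then show ?thesis by auto
  qed
  then have "{X \<in> units. \<forall>i. log_size X i \<le> M}
      \<subseteq> {X. \<forall>a. X $ a \<in> {v. \<forall>b. v $ b \<in> {- \<lceil>C\<rceil>..\<lceil>C\<rceil>}}}"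
    by blast
  then show ?thesis
    by (rule finite_subset) (intro finite_vec_entries finite_atLeastAtMost_int)
qed

definition small_units :: "(int ^ 'n ^ 'n) set" where
  "small_units = {X \<in> units. \<forall>i. log_size X i \<le> CARD('n)}"

text \<open>Drop one coordinate \<open>i0\<close> and round the others down. Two units with the same rounded vector have a
quotient whose logarithms are at most one in absolute value away from \<open>i0\<close>, and thus also bounded
at \<open>i0\<close> because the coordinates sum to zero. Each of the
\<open>(2 * r + 1) ^ (CARD('n) - 1)\<close> cells hence contains at most \<open>card small_units\<close> units.\<close>

lemma card_units_log_box:
  fixes r :: nat
  defines "S \<equiv> {X \<in> units. \<forall>i. \<bar>log_size X i\<bar> \<le> r}"
  shows "finite S \<and> card S \<le> card small_units * (2 * r + 1) ^ (CARD('n) - 1)"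
proof -
  obtain i0 :: 'n where True by blast
  define T :: "('n \<Rightarrow> int) set" where "T = (UNIV - {i0}) \<rightarrow>\<^sub>E {- int r..int r}"
  define \<phi> where "\<phi> = (\<lambda>X. \<lambda>i\<in>UNIV - {i0}. \<lfloor>log_size X i\<rfloor>)"
  have T: "finite T" "card T = (2 * r + 1) ^ (CARD('n) - 1)"
    by (simp_all add: T_def finite_PiE card_PiE card_Diff_singleton nat_add_distrib nat_mult_distrib)
  have "\<lfloor>log_size X i\<rfloor> \<in> {- int r..int r}" if "X \<in> S" for X i
  proof -
    have "\<bar>log_size X i\<bar> \<le> r" using that by (simp add: S_def)
    then have "- real r \<le> log_size X i" "log_size X i < real r + 1" by linarith+
    then show ?thesis by (simp add: le_floor_iff floor_le_iff)
  qed
  then have "\<phi> X \<in> T" if "X \<in> S" for X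
    unfolding \<phi>_def T_def restrict_PiE_iff using that by blast
  then have "\<phi> ` S \<subseteq> T" by blast
  moreover have "finite {X \<in> S. \<phi> X = t} \<and> card {X \<in> S. \<phi> X = t} \<le> card small_units" for t
  proof (cases "{X \<in> S. \<phi> X = t} = {}")
    case False
    then obtain X where X: "X \<in> units" "\<phi> X = t" by (auto simp: S_def)
    obtain X' where X': "X' \<in> units" "X ** X' = mat 1"
      using units_inverse[OF X(1)] by blast
    have inv: "log_size X' i = - log_size X i" for i
      using log_size_mult[OF X(1) X'(1), of i] X'(2) by (simp add: log_size_one)
    have "{X \<in> S. \<phi> X = t} \<subseteq> (**) X ` small_units"
    proof
      fix Y assume "Y \<in> {X \<in> S. \<phi> X = t}"
      then have Y: "Y \<in> units" "\<phi> Y = \<phi> X" by (auto simp: S_def X)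
      let ?Z = "X' ** Y"
      have Z: "?Z \<in> units" using X' Y by (intro units_mult)
      have lZ: "log_size ?Z i = log_size Y i - log_size X i" for i
        using log_size_mult[OF X'(1) Y(1)] inv by simp
      have small: "\<bar>log_size ?Z i\<bar> \<le> 1" if "i \<noteq> i0" for i
      proof -
        have "\<lfloor>log_size Y i\<rfloor> = \<lfloor>log_size X i\<rfloor>"
          using fun_cong[OF Y(2), of i] that by (simp add: \<phi>_def)
        then show ?thesis unfolding lZ by linarith
      qed
      have "log_size ?Z i0 = - (\<Sum>i\<in>UNIV - {i0}. log_size ?Z i)"
        using sum_log_size[OF Z] sum.remove[of UNIV i0 "log_size ?Z"] by simp
      also have "\<dots> \<le> (\<Sum>i\<in>UNIV - {i0}. \<bar>log_size ?Z i\<bar>)"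
        using sum_abs[of "log_size ?Z" "UNIV - {i0}"] by linarith
      also have "\<dots> \<le> (\<Sum>i\<in>UNIV - {i0}. 1)"
        by (rule sum_mono) (simp add: small)
      also have "\<dots> \<le> CARD('n)"
        by (simp add: card_Diff_singleton)
      finally have "log_size ?Z i0 \<le> CARD('n)" .
      moreover have "log_size ?Z i \<le> CARD('n)" if "i \<noteq> i0" for i
      proof -
        have "1 \<le> CARD('n)" by (simp add: Suc_leI)
        then have "1 \<le> real CARD('n)" by linarith
        then show ?thesis using small[OF that] by linarith
      qed
      ultimately have "log_size ?Z i \<le> CARD('n)" for i
        by (cases "i = i0") auto
      then have "?Z \<in> small_units"
        unfolding small_units_def using Z by blast
      moreover have "Y = X ** ?Z" using X'(2) by (simp add: matrix_mul_assoc)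
      ultimately show "Y \<in> (**) X ` small_units" by blast
    qed
    moreover have "finite small_units"
      unfolding small_units_def by (rule finite_bounded_units)
    ultimately show ?thesis
      by (meson card_image_le card_mono finite_imageI finite_subset order_trans)
  next
    case True
    show ?thesis unfolding True by simp
  qed
  ultimately have "finite S \<and> card S \<le> card small_units * card T"
    using card_le_fibres[OF T(1)] by blast
  then show ?thesis by (simp add: T)
qed

text \<open>There are \<open>(N + 1) ^ n\<close> indices, but their images lie in a logarithmic box of size linear in \<open>N\<close>,
which holds only \<open>O(N ^ (n - 1))\<close> units, for \<open>n = CARD('n)\<close>. Two indices must share an image.\<close>

lemma unit_family_linear_growth_not_inj:
  fixes I :: "nat \<Rightarrow> 's set" and F :: "'s \<Rightarrow> int ^ 'n ^ 'n" and c :: nat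
  assumes card: "\<And>N. finite (I N) \<and> card (I N) = (N + 1) ^ CARD('n)"
    and bnd: "\<And>N s. s \<in> I N \<Longrightarrow> F s \<in> units \<and> (\<forall>i. \<bar>log_size (F s) i\<bar> \<le> c * N)"
  shows "\<exists>N. \<exists>s\<in>I N. \<exists>t\<in>I N. s \<noteq> t \<and> F s = F t"
proof -
  let ?n = "CARD('n)"
  \<comment> \<open>Chosen so that the bound of the box count falls just short of \<open>(N + 1) ^ n\<close>.\<close>
  define N where "N = card small_units * (2 * c + 1) ^ (?n - 1)"
  let ?S = "{X \<in> units. \<forall>i. \<bar>log_size X i\<bar> \<le> real (c * N)}"
  have "\<not> inj_on F (I N)"
  proof
    assume "inj_on F (I N)"
    then have "(N + 1) ^ ?n = card (F ` I N)"
      by (simp add: card_image card)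
    also have "\<dots> \<le> card ?S"
      using card_units_log_box[of "c * N"] bnd[of _ N] by (intro card_mono) auto
    also have "\<dots> \<le> card small_units * (2 * (c * N) + 1) ^ (?n - 1)"
      using card_units_log_box[of "c * N"] by simp
    also have "\<dots> \<le> card small_units * ((2 * c + 1) * (N + 1)) ^ (?n - 1)"
      by (intro mult_left_mono power_mono) (simp_all add: algebra_simps)
    also have "\<dots> = N * (N + 1) ^ (?n - 1)"
      unfolding power_mult_distrib by (simp only: N_def mult.assoc)
    also have "\<dots> < (N + 1) * (N + 1) ^ (?n - 1)" by simp
    also have "\<dots> = (N + 1) ^ ?n"
      by (metis One_nat_def Suc_pred power_Suc zero_less_card_finite)
    finally show False by simp
  qed
  then show ?thesis unfolding inj_on_def by blast
qed

end


section \<open>Relations in the centralizer\<close>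

lemma int_iterate_diff:
  assumes "bij f"
  shows "int_iterate f (int a - int b) \<circ> f ^^ b = f ^^ a"
    and "f ^^ b \<circ> int_iterate f (int a - int b) = f ^^ a"
proof -
  have "int_iterate f (int a - int b) \<circ> f ^^ b = f ^^ a \<and> f ^^ b \<circ> int_iterate f (int a - int b) = f ^^ a"
  proof (cases "b \<le> a")
    case True
    then have "int_iterate f (int a - int b) = f ^^ (a - b)"
      by (simp add: int_iterate_def nat_diff_distrib)
    then show ?thesis using True by (simp add: funpow_add[symmetric])
  next
    case False
    then have "int_iterate f (int a - int b) = inv (f ^^ (b - a))"
      by (simp add: int_iterate_def inv_fn[OF assms] nat_diff_distrib)
    moreover have "f ^^ b = f ^^ (b - a) \<circ> f ^^ a" "f ^^ b = f ^^ a \<circ> f ^^ (b - a)"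
      using False by (simp_all add: funpow_add[symmetric])
    moreover have "bij (f ^^ (b - a))" by (rule bij_fn[OF assms])
    then have "inv (f ^^ (b - a)) \<circ> f ^^ (b - a) = id" "f ^^ (b - a) \<circ> inv (f ^^ (b - a)) = id"
      by (simp_all add: bij_is_inj inv_o_cancel bij_is_surj flip: surj_iff)
    ultimately show ?thesis by (metis comp_assoc comp_id id_comp)
  qed
  then show "int_iterate f (int a - int b) \<circ> f ^^ b = f ^^ a"
    "f ^^ b \<circ> int_iterate f (int a - int b) = f ^^ a" by auto
qed

lemma funpow_commute:
  assumes "f \<circ> p = p \<circ> f"
  shows "f ^^ k \<circ> p = p \<circ> f ^^ k"
proof (induction k)
  case (Suc k)
  have "f ^^ Suc k \<circ> p = f \<circ> (f ^^ k \<circ> p)" by (simp add: comp_assoc)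
  also have "\<dots> = (f \<circ> p) \<circ> f ^^ k" by (simp only: Suc comp_assoc)
  also have "\<dots> = p \<circ> f ^^ Suc k" by (simp add: assms comp_assoc)
  finally show ?case .
qed simp

lemma inv_commute:
  assumes "bij f" "f \<circ> p = p \<circ> f"
  shows "inv f \<circ> p = p \<circ> inv f"
proof
  fix x
  have "f (p (inv f x)) = p x"
    using fun_cong[OF assms(2), of "inv f x"] assms(1) by (simp add: bij_is_surj surj_f_inv_f)
  then show "(inv f \<circ> p) x = (p \<circ> inv f) x"
    using assms(1) by (metis bij_inv_eq_iff comp_apply)
qed

lemma int_iterate_commute:
  assumes "bij f" "f \<circ> p = p \<circ> f"
  shows "int_iterate f k \<circ> p = p \<circ> int_iterate f k"
  using funpow_commute[OF assms(2)] funpow_commute[OF inv_commute[OF assms]]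
  by (simp add: int_iterate_def)

text \<open>The two words are compared by cancelling \<open>f ^^ i' \<circ> g ^^ j'\<close> on the left and \<open>h ^^ k'\<close> on the
right. The exponents of \<open>f\<close> are merged by moving a power of \<open>f\<close> across a power of \<open>g\<close>, while
those of \<open>h\<close> are already adjacent: the maps \<open>g\<close> and \<open>h\<close> are never interchanged.\<close>

lemma coincidence_imp_relation:
  assumes bij: "bij f" "bij g" "bij h" and comm: "g \<circ> f = f \<circ> g"
    and eq: "f ^^ i \<circ> g ^^ j \<circ> h ^^ k = f ^^ i' \<circ> g ^^ j' \<circ> h ^^ k'"
  shows "int_iterate f (int i - int i') \<circ> int_iterate g (int j - int j')
    \<circ> int_iterate h (int k - int k') = id"
proof -
  define a where "a = int_iterate f (int i - int i')"
  define b where "b = int_iterate g (int j - int j')"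
  define c where "c = int_iterate h (int k - int k')"
  have "f \<circ> g ^^ j' = g ^^ j' \<circ> f" using funpow_commute[OF comm] by (rule sym)
  then have acomm: "a \<circ> g ^^ j' = g ^^ j' \<circ> a"
    unfolding a_def by (rule int_iterate_commute[OF bij(1)])
  have "(f ^^ i' \<circ> g ^^ j') \<circ> (a \<circ> b \<circ> c) \<circ> h ^^ k'
      = (f ^^ i' \<circ> (g ^^ j' \<circ> a)) \<circ> b \<circ> (c \<circ> h ^^ k')"
    by (simp only: comp_assoc)
  also have "\<dots> = (f ^^ i' \<circ> a) \<circ> (g ^^ j' \<circ> b) \<circ> (c \<circ> h ^^ k')"
    by (simp only: acomm[symmetric] comp_assoc)
  also have "\<dots> = f ^^ i \<circ> g ^^ j \<circ> h ^^ k"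
    unfolding a_def b_def c_def by (simp only: int_iterate_diff bij)
  also have "\<dots> = (f ^^ i' \<circ> g ^^ j') \<circ> h ^^ k'" by (rule eq)
  finally have main: "(f ^^ i' \<circ> g ^^ j') \<circ> (a \<circ> b \<circ> c) \<circ> h ^^ k' = (f ^^ i' \<circ> g ^^ j') \<circ> h ^^ k'" .
  have inj: "inj (f ^^ i' \<circ> g ^^ j')"
    using bij by (intro inj_compose inj_fn bij_is_inj)
  have surj: "surj (h ^^ k')" by (intro surj_fn bij_is_surj bij)
  have "(a \<circ> b \<circ> c) x = x" for x
  proof -
    obtain y where y: "x = (h ^^ k') y" using surj by blast
    have "(f ^^ i' \<circ> g ^^ j') ((a \<circ> b \<circ> c) x) = (f ^^ i' \<circ> g ^^ j') x"
      using fun_cong[OF main, of y] by (simp add: y)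
    then show ?thesis using inj by (simp only: inj_eq)
  qed
  then show ?thesis unfolding a_def b_def c_def by (simp add: fun_eq_iff)
qed

text \<open>The notation \<open>^\<close> on the vector type of matrices would denote entrywise powers.\<close>

definition mat_pow :: "int ^ 'n ^ 'n \<Rightarrow> nat \<Rightarrow> int ^ 'n ^ 'n" where
  "mat_pow B k = ((**) B ^^ k) (mat 1)"

lemma toral_endo_mat_pow:
  fixes B :: "int ^ 'n ^ 'n::finite"
  shows "toral_endo (mat_pow B k) = toral_endo B ^^ k"
  by (induction k) (simp_all add: mat_pow_def toral_endo_one toral_endo_mult)

context hyperbolic_eigenbasis
begin

lemma A_unit: "A \<in> units"
  using unimodular by (simp add: units_def)

lemma mat_pow_units: "B \<in> units \<Longrightarrow> mat_pow B k \<in> units"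
  by (induction k) (simp_all add: mat_pow_def units_one units_mult)

lemma log_size_mat_pow: "B \<in> units \<Longrightarrow> log_size (mat_pow B k) i = k * log_size B i"
proof (induction k)
  case (Suc k)
  have "mat_pow B (Suc k) = B ** mat_pow B k" by (simp add: mat_pow_def)
  then show ?case
    using Suc by (simp add: log_size_mult mat_pow_units algebra_simps)
qed (simp add: mat_pow_def log_size_one)

text \<open>A map commuting with \<open>toral_endo A\<close> permutes the finite set of fixed points of \<open>toral_endo A\<close>, so
some power of it fixes the origin and is linear by \<open>commuting_lift_linear\<close>. The same applies to
the inverse map, which makes the matrix invertible over the integers.\<close>

lemma centralizer_power_linear:
  assumes "g \<in> C1_centralizer (toral_endo A)"
  obtains L B where "L > 0" "B \<in> units" "g ^^ L = toral_endo B"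
proof -
  let ?f = "toral_endo A" and ?o = "torus_proj 0"
  have g: "bij g" "torus_C1 g" "torus_C1 (inv g)" "g \<circ> ?f = ?f \<circ> g"
    using assms by (auto simp: C1_centralizer_def torus_C1_diffeo_def)
  have f0: "?f ?o = ?o" by (simp add: toral_endo.abs_eq)
  have "{y. \<exists>n. y = (g ^^ n) ?o} \<subseteq> {p. ?f p = p}"
  proof safe
    fix n
    show "?f ((g ^^ n) ?o) = (g ^^ n) ?o"
      using fun_cong[OF funpow_commute[OF g(4), of n], of ?o] f0 by simp
  qed
  then have "finite {y. \<exists>n. y = (g ^^ n) ?o}"
    using finite_subset finite_toral_endo_fixed_points[OF fixed_vector_zero] by blast
  then obtain L where L: "L > 0" "(g ^^ L) ?o = ?o"
    using funpow_inj_finite[OF bij_is_inj[OF g(1)]] by metis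
  have bijL: "bij (g ^^ L)" by (rule bij_fn[OF g(1)])
  have invL: "inv (g ^^ L) = inv g ^^ L" by (rule inv_fn[OF g(1)])
  obtain G where G: "torus_lift G g" by (rule torus_C1_lift[OF g(2)])
  obtain G' where G': "torus_lift G' (inv g)" by (rule torus_C1_lift[OF g(3)])
  have comm: "g ^^ L \<circ> ?f = ?f \<circ> g ^^ L" by (rule funpow_commute[OF g(4)])
  obtain B where B: "g ^^ L = toral_endo B"
    by (rule commuting_lift_linear[OF torus_lift_funpow[OF G] comm L(2)])
  have "inv (g ^^ L) ?o = ?o" using L(2) bijL by (metis bij_inv_eq_iff)
  then obtain B' where B': "inv (g ^^ L) = toral_endo B'"
    using commuting_lift_linear[OF torus_lift_funpow[OF G', of L]] inv_commute[OF bijL comm]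
    unfolding invL by metis
  have "toral_endo (B ** B') = toral_endo (mat 1)" "toral_endo (B' ** B) = toral_endo (mat 1)"
    using bijL by (simp_all add: toral_endo_mult toral_endo_one flip: B B')
      (simp_all add: bij_is_inj bij_is_surj flip: surj_iff)
  then have "invertible B" by (auto simp: toral_endo_inject invertible_def)
  moreover have "A ** B = B ** A"
    using comm unfolding B toral_endo_mult[symmetric] toral_endo_inject by (rule sym)
  ultimately have "B \<in> units" by (simp add: units_def)
  then show thesis using that L(1) B by blast
qed

lemma log_size_bound:
  fixes B :: "int ^ 'n ^ 'n"
  obtains c :: nat where "\<And>i. \<bar>log_size B i\<bar> \<le> c"
proof -
  have "\<bar>log_size B i\<bar> \<le> (\<Sum>i\<in>UNIV. \<bar>log_size B i\<bar>)" for i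
    by (rule member_le_sum) auto
  then show thesis
    using that[of "nat \<lceil>\<Sum>i\<in>UNIV. \<bar>log_size B i\<bar>\<rceil>"] by (meson of_nat_ceiling order_trans)
qed

lemma log_size_mat_pow_bound:
  assumes "B \<in> units" "\<And>i. \<bar>log_size B i\<bar> \<le> real c" "k \<le> N"
  shows "\<bar>log_size (mat_pow B k) i\<bar> \<le> c * real N"
  using mult_mono[of "real k" "real N" "\<bar>log_size B i\<bar>" "real c"] assms
  by (simp add: log_size_mat_pow abs_mult mult.commute)

text \<open>Logarithms of \<open>mat_pow B k\<close> are linear in \<open>k\<close>, so pairs of exponents up to \<open>N\<close> form a family to
which the pigeonhole applies. In dimension three the same works for triples.\<close>

lemma unit_powers_coincide_dim2:
  assumes "CARD('n) = 2" "B \<in> units"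
  obtains i j i' j' where "(i, j) \<noteq> (i', j')"
    "mat_pow A i ** mat_pow B j = mat_pow A i' ** mat_pow B j'"
proof -
  obtain a b where ab: "\<And>i. \<bar>log_size A i\<bar> \<le> real a" "\<And>i. \<bar>log_size B i\<bar> \<le> real b"
    using log_size_bound by metis
  let ?F = "\<lambda>(i, j). mat_pow A i ** mat_pow B j"
  have "\<exists>N. \<exists>s\<in>{..N} \<times> {..N}. \<exists>t\<in>{..N} \<times> {..N}. s \<noteq> t \<and> ?F s = ?F t"
  proof (rule unit_family_linear_growth_not_inj)
    show "finite ({..N} \<times> {..N}) \<and> card ({..N} \<times> {..N}) = (N + 1) ^ CARD('n)" for N :: nat
      by (simp add: card_cartesian_product assms power2_eq_square)
  next
    fix N :: nat and s assume s: "s \<in> {..N} \<times> {..N}"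
    obtain i j where ij: "s = (i, j)" "i \<le> N" "j \<le> N" using s by auto
    note u = mat_pow_units[OF A_unit] mat_pow_units[OF assms(2)]
    have "\<bar>log_size (?F s) k\<bar> \<le> real ((a + b) * N)" for k
      using log_size_mat_pow_bound[OF A_unit ab(1) ij(2), of k]
        log_size_mat_pow_bound[OF assms(2) ab(2) ij(3), of k]
      by (simp add: ij(1) log_size_mult u algebra_simps)
    then show "?F s \<in> units \<and> (\<forall>k. \<bar>log_size (?F s) k\<bar> \<le> real ((a + b) * N))"
      using u by (simp add: ij(1) units_mult)
  qed
  then obtain s t where "s \<noteq> t" "?F s = ?F t" by (elim exE bexE conjE) (rule that)
  moreover obtain i j where "s = (i, j)" by (rule prod.exhaust)
  moreover obtain i' j' where "t = (i', j')" by (rule prod.exhaust)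
  ultimately have "(i, j) \<noteq> (i', j')"
    "mat_pow A i ** mat_pow B j = mat_pow A i' ** mat_pow B j'" by simp_all
  then show thesis by (rule that)
qed

lemma unit_powers_coincide_dim3:
  assumes "CARD('n) = 3" "B \<in> units" "C \<in> units"
  obtains i j k i' j' k' where "(i, j, k) \<noteq> (i', j', k')"
    "mat_pow A i ** mat_pow B j ** mat_pow C k = mat_pow A i' ** mat_pow B j' ** mat_pow C k'"
proof -
  obtain a b c where abc: "\<And>i. \<bar>log_size A i\<bar> \<le> real a" "\<And>i. \<bar>log_size B i\<bar> \<le> real b"
    "\<And>i. \<bar>log_size C i\<bar> \<le> real c"
    using log_size_bound by metis
  let ?F = "\<lambda>(i, j, k). mat_pow A i ** mat_pow B j ** mat_pow C k"
  let ?I = "\<lambda>N::nat. {..N} \<times> {..N} \<times> {..N}"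
  have "\<exists>N. \<exists>s\<in>?I N. \<exists>t\<in>?I N. s \<noteq> t \<and> ?F s = ?F t"
  proof (rule unit_family_linear_growth_not_inj)
    show "finite (?I N) \<and> card (?I N) = (N + 1) ^ CARD('n)" for N
      by (simp add: card_cartesian_product assms power3_eq_cube)
  next
    fix N :: nat and s assume s: "s \<in> ?I N"
    obtain i j k where ijk: "s = (i, j, k)" "i \<le> N" "j \<le> N" "k \<le> N" using s by auto
    note u = mat_pow_units[OF A_unit] mat_pow_units[OF assms(2)] mat_pow_units[OF assms(3)]
    have "\<bar>log_size (?F s) e\<bar> \<le> real ((a + b + c) * N)" for e
      using log_size_mat_pow_bound[OF A_unit abc(1) ijk(2), of e]
        log_size_mat_pow_bound[OF assms(2) abc(2) ijk(3), of e]
        log_size_mat_pow_bound[OF assms(3) abc(3) ijk(4), of e]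
      by (simp add: ijk(1) log_size_mult units_mult u algebra_simps)
    then show "?F s \<in> units \<and> (\<forall>e. \<bar>log_size (?F s) e\<bar> \<le> real ((a + b + c) * N))"
      using u by (simp add: ijk(1) units_mult)
  qed
  then obtain s t where "s \<noteq> t" "?F s = ?F t" by (elim exE bexE conjE) (rule that)
  moreover obtain i j k where "s = (i, j, k)" by (rule prod_cases3)
  moreover obtain i' j' k' where "t = (i', j', k')" by (rule prod_cases3)
  ultimately have "(i, j, k) \<noteq> (i', j', k')"
    "mat_pow A i ** mat_pow B j ** mat_pow C k = mat_pow A i' ** mat_pow B j' ** mat_pow C k'"
    by simp_all
  then show thesis by (rule that)
qed

lemma bij_toral_endo: "bij (toral_endo A)"
proof -
  obtain A' where "A ** A' = mat 1" "A' ** A = mat 1"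
    using unimodular by (auto simp: invertible_def)
  then have "toral_endo A \<circ> toral_endo A' = id" "toral_endo A' \<circ> toral_endo A = id"
    by (simp_all add: toral_endo_one flip: toral_endo_mult)
  then show ?thesis by (metis o_bij)
qed

lemma centralizer_relation_dim2:
  assumes "CARD('n) = 2" "g \<in> C1_centralizer (toral_endo A)"
  shows "\<exists>k l :: int. \<not> (k = 0 \<and> l = 0) \<and>
    int_iterate (toral_endo A) k \<circ> int_iterate g l = id"
proof -
  obtain L B where L: "L > 0" "B \<in> units" "g ^^ L = toral_endo B"
    using centralizer_power_linear[OF assms(2)] by blast
  obtain i j i' j' where ne: "(i, j) \<noteq> (i', j')"
    and eq: "mat_pow A i ** mat_pow B j = mat_pow A i' ** mat_pow B j'"
    using unit_powers_coincide_dim2[OF assms(1) L(2)] by blast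
  have pow: "toral_endo (mat_pow B j) = g ^^ (L * j)" for j
    by (simp add: toral_endo_mat_pow funpow_mult flip: L(3))
  have g: "bij g" "g \<circ> toral_endo A = toral_endo A \<circ> g"
    using assms(2) by (auto simp: C1_centralizer_def torus_C1_diffeo_def)
  \<comment> \<open>A trivial third factor makes the three-map lemma applicable.\<close>
  have "toral_endo A ^^ i \<circ> g ^^ (L * j) \<circ> id ^^ 0
      = toral_endo A ^^ i' \<circ> g ^^ (L * j') \<circ> id ^^ 0"
    using arg_cong[OF eq, of toral_endo] by (simp add: toral_endo_mult toral_endo_mat_pow[of A] pow)
  from coincidence_imp_relation[OF bij_toral_endo g(1) bij_id g(2) this]
  have "int_iterate (toral_endo A) (int i - int i') \<circ> int_iterate g (int (L * j) - int (L * j')) = id"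
    by (simp add: int_iterate_def)
  moreover have "\<not> (int i - int i' = 0 \<and> int (L * j) - int (L * j') = 0)"
    using ne L(1) by simp
  ultimately show ?thesis by blast
qed

text \<open>Passing to powers that are linear replaces the three maps by three units. A coincidence between
products of their powers is a relation between \<open>toral_endo A\<close>, \<open>g\<close> and \<open>h\<close> whose exponents at \<open>g\<close>
and \<open>h\<close> are multiplied by the positive numbers \<open>L\<close> and \<open>M\<close>, and so remain nontrivial.\<close>

lemma centralizer_relation_dim3:
  assumes "CARD('n) = 3" "g \<in> C1_centralizer (toral_endo A)" "h \<in> C1_centralizer (toral_endo A)"
  shows "\<exists>k l m :: int. \<not> (k = 0 \<and> l = 0 \<and> m = 0) \<and>
    int_iterate (toral_endo A) k \<circ> int_iterate g l \<circ> int_iterate h m = id"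
proof -
  obtain L B where L: "L > 0" "B \<in> units" "g ^^ L = toral_endo B"
    using centralizer_power_linear[OF assms(2)] by blast
  obtain M C where M: "M > 0" "C \<in> units" "h ^^ M = toral_endo C"
    using centralizer_power_linear[OF assms(3)] by blast
  obtain i j k i' j' k' where ne: "(i, j, k) \<noteq> (i', j', k')"
    and eq: "mat_pow A i ** mat_pow B j ** mat_pow C k = mat_pow A i' ** mat_pow B j' ** mat_pow C k'"
    using unit_powers_coincide_dim3[OF assms(1) L(2) M(2)] by blast
  have pow: "toral_endo (mat_pow B j) = g ^^ (L * j)" "toral_endo (mat_pow C j) = h ^^ (M * j)" for j
    by (simp_all add: toral_endo_mat_pow funpow_mult flip: L(3) M(3))
  have g: "bij g" "g \<circ> toral_endo A = toral_endo A \<circ> g" and h: "bij h"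
    using assms(2,3) by (auto simp: C1_centralizer_def torus_C1_diffeo_def)
  have "toral_endo A ^^ i \<circ> g ^^ (L * j) \<circ> h ^^ (M * k)
      = toral_endo A ^^ i' \<circ> g ^^ (L * j') \<circ> h ^^ (M * k')"
    using arg_cong[OF eq, of toral_endo] by (simp add: toral_endo_mult toral_endo_mat_pow[of A] pow)
  from coincidence_imp_relation[OF bij_toral_endo g(1) h g(2) this]
  have "int_iterate (toral_endo A) (int i - int i') \<circ> int_iterate g (int (L * j) - int (L * j'))
    \<circ> int_iterate h (int (M * k) - int (M * k')) = id" .
  moreover have "\<not> (int i - int i' = 0 \<and> int (L * j) - int (L * j') = 0 \<and> int (M * k) - int (M * k') = 0)"
    using ne L(1) M(1) by simp
  ultimately show ?thesis by blast
qed

end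

theorem corollary5:
  fixes f :: "'n::finite torus \<Rightarrow> 'n torus"
  assumes "CARD('n) \<ge> 2"
    and "linear_anosov f"
  shows "(CARD('n) = 2 \<longrightarrow>
            (\<forall>g \<in> C1_centralizer f.
               \<exists>k l :: int. \<not> (k = 0 \<and> l = 0) \<and>
                 int_iterate f k \<circ> int_iterate g l = id))
       \<and> (CARD('n) = 3 \<longrightarrow>
            (\<forall>g \<in> C1_centralizer f. \<forall>h \<in> C1_centralizer f.
               \<exists>k l m :: int. \<not> (k = 0 \<and> l = 0 \<and> m = 0) \<and>
                 int_iterate f k \<circ> int_iterate g l \<circ> int_iterate h m = id))"
proof -
  obtain A :: "int ^ 'n ^ 'n" where A: "invertible A"
    "\<forall>c. complex_eigenvalue A c \<longrightarrow> cmod c \<noteq> 1" and f: "f = toral_endo A"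
    using assms(2)[unfolded linear_anosov_def] by (elim exE conjE) (rule that)
  have eigenbasis: "\<exists>P Q l. hyperbolic_eigenbasis A P Q l" if n: "CARD('n) = 2 \<or> CARD('n) = 3"
  proof (rule hyperbolic_diagonalizable[OF n A(1)])
    show "cmod c \<noteq> 1" if "complex_eigenvalue A c" for c using A(2) that by blast
  next
    fix P Q :: "complex ^ 'n ^ 'n" and l
    assume "P ** Q = mat 1" "Q ** P = mat 1" "Q ** cmat A ** P = diag l" "inj l"
      "\<And>i. cmod (l i) \<noteq> 1"
    then have "hyperbolic_eigenbasis A P Q l"
      using A(1) by (intro hyperbolic_eigenbasis.intro)
    then show ?thesis by (intro exI)
  qed
  show ?thesis
    unfolding f
  proof (intro conjI impI ballI)
    assume n: "CARD('n) = 2"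
    then obtain P Q l where "hyperbolic_eigenbasis A P Q l" using eigenbasis by blast
    then interpret hyperbolic_eigenbasis A P Q l .
    fix g assume "g \<in> C1_centralizer (toral_endo A)"
    then show "\<exists>k l :: int. \<not> (k = 0 \<and> l = 0) \<and>
        int_iterate (toral_endo A) k \<circ> int_iterate g l = id"
      by (rule centralizer_relation_dim2[OF n])
  next
    assume n: "CARD('n) = 3"
    then obtain P Q l where "hyperbolic_eigenbasis A P Q l" using eigenbasis by blast
    then interpret hyperbolic_eigenbasis A P Q l .
    fix g h assume "g \<in> C1_centralizer (toral_endo A)" "h \<in> C1_centralizer (toral_endo A)"
    then show "\<exists>k l m :: int. \<not> (k = 0 \<and> l = 0 \<and> m = 0) \<and>
        int_iterate (toral_endo A) k \<circ> int_iterate g l \<circ> int_iterate h m = id"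
      by (rule centralizer_relation_dim3[OF n])
  qed
qed

end
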